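(* Let $d\ge 3$ be an integer, let $\ell\in\tfrac12+\mathbb{N}_0$, and let $\mathfrak{g}=\widehat{\mathfrak{cga}}_\ell(d,\mathbb{C})$ be the mass central extension of the complex conformal Galilei algebra. Then $H^2(\mathfrak{g},\mathfrak{g})=0$.
   Context: $\mathbb{N}_0=\{0,1,2,\dots\}$. For an integer $d\ge 1$ and $\ell\in\frac12+\mathbb{N}_0$, the mass central extension $\widehat{\mathfrak{cga}}_\ell(d,\mathbb{C})$ is the complex Lie algebra with basis $C,D,H$, $M_{i,j}$ ($1\le i<j\le d$), $P_{n,i}$ ($0\le n\le 2\ell$, $1\le i\le d$), and a central element $M$, with the convention $M_{j,i}=-M_{i,j}$, $M_{i,i}=0$, and non-trivial brackets \begin{align*} [M_{i,j},M_{k,r}]&=-\delta_{i,k}M_{j,r}-\delta_{j,r}M_{i,k}+\delta_{i,r}M_{j,k}+\delta_{j,k}M_{i,r},\\ [D,H]&=2H,\quad [C,H]=D,\quad [D,C]=-2C,\\ [M_{i,j},P_{n,k}]&=-\delta_{i,k}P_{n,j}+\delta_{j,k}P_{n,i},\\ [H,P_{n,i}]&=-nP_{n-1,i},\quad [D,P_{n,i}]=2(\ell-n)P_{n,i},\quad [C,P_{n,i}]=(2\ell-n)P_{n+1,i},\\ [P_{m,i},P_{n,j}]&=\delta_{i,j}\,\delta_{m+n,2\ell}\,b_m\,M,\qquad b_m=(-1)^{m+\ell+\frac12}(2\ell-m)!\,m!. \end{align*} All other brackets of basis elements (not following by antisymmetry) vanish. $H^2(\mathfrak{g},\mathfrak{g})$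 is the second Chevalley–Eilenberg cohomology space of $\mathfrak{g}$ with coefficients in the adjoint module. *)

theory Defs
  imports Complex_Main "HOL-Library.Function_Algebras"
begin

section \<open>Chevalley--Eilenberg cohomology\<close>

text \<open>
  A Lie algebra over a field is given by a scaling, a carrier \<open>L\<close> (a subspace of the ambient
  type) and a bracket; a module over it by a scaling, a carrier \<open>N\<close> and an action.
  An \<open>n\<close>-cochain is an alternating \<open>n\<close>-linear map from \<open>L\<close> to \<open>N\<close>, represented as a function on
  lists that is \<open>0\<close> off the \<open>n\<close>-tuples over \<open>L\<close>, so that equality of functions is
  equality of cochains.
\<close>

definition tuples :: "'v set \<Rightarrow> nat \<Rightarrow> 'v list set" where
  "tuples L n = {xs. set xs \<subseteq> L \<and> length xs = n}"

definition omit_nth :: "nat \<Rightarrow> 'v list \<Rightarrow> 'v list" where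
  "omit_nth i xs = take i xs @ drop (Suc i) xs"

definition CE_cochains ::
  "('k::field \<Rightarrow> 'v::ab_group_add \<Rightarrow> 'v) \<Rightarrow> 'v set \<Rightarrow>
   ('k \<Rightarrow> 'w::ab_group_add \<Rightarrow> 'w) \<Rightarrow> 'w set \<Rightarrow> nat \<Rightarrow> ('v list \<Rightarrow> 'w) set" where
  "CE_cochains scL L scN N n = {f.
     (\<forall>xs \<in> tuples L n. f xs \<in> N) \<and>
     (\<forall>xs. xs \<notin> tuples L n \<longrightarrow> f xs = 0) \<and>
     (\<forall>xs \<in> tuples L n. \<forall>i<n. \<forall>y \<in> L. f (xs[i := xs ! i + y]) = f xs + f (xs[i := y])) \<and>
     (\<forall>xs \<in> tuples L n. \<forall>i<n. \<forall>c. f (xs[i := scL c (xs ! i)]) = scN c (f xs)) \<and>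
     (\<forall>xs \<in> tuples L n. \<forall>j<n. \<forall>i<j. xs ! i = xs ! j \<longrightarrow> f xs = 0)}"

text \<open>
  The differential from \<open>n\<close>-cochains to \<open>(n+1)\<close>-cochains, with arguments numbered from \<open>0\<close>.
  In the second sum position \<open>j\<close> is deleted before the smaller position \<open>i\<close>, so the latter is
  not shifted.
\<close>

definition CE_diff ::
  "'v set \<Rightarrow> ('v \<Rightarrow> 'v \<Rightarrow> 'v) \<Rightarrow> ('k::field \<Rightarrow> 'w::ab_group_add \<Rightarrow> 'w) \<Rightarrow> ('v \<Rightarrow> 'w \<Rightarrow> 'w) \<Rightarrow>
   nat \<Rightarrow> ('v list \<Rightarrow> 'w) \<Rightarrow> 'v list \<Rightarrow> 'w" where
  "CE_diff L br scN act n f xs =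
     (if xs \<in> tuples L (Suc n) then
        (\<Sum>i\<le>n. scN ((-1) ^ i) (act (xs ! i) (f (omit_nth i xs)))) +
        (\<Sum>j\<le>n. \<Sum>i<j. scN ((-1) ^ (i + j))
            (f (br (xs ! i) (xs ! j) # omit_nth i (omit_nth j xs))))
      else 0)"

definition CE_cocycles where
  "CE_cocycles scL L br scN N act n =
     {f \<in> CE_cochains scL L scN N n. CE_diff L br scN act n f = (\<lambda>_. 0)}"

definition CE_coboundaries where
  "CE_coboundaries scL L br scN N act n =
     (case n of 0 \<Rightarrow> {\<lambda>_. 0} | Suc m \<Rightarrow> CE_diff L br scN act m ` CE_cochains scL L scN N m)"

text \<open>The quotient space of cocycles modulo coboundaries, as the set of cosets.\<close>

definition CE_cohomology where
  "CE_cohomology scL L br scN N act n =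
     (\<lambda>f. {\<lambda>xs. f xs + g xs | g. g \<in> CE_coboundaries scL L br scN N act n})
       ` CE_cocycles scL L br scN N act n"

abbreviation adjoint_cohomology where
  "adjoint_cohomology sc L br \<equiv> CE_cohomology sc L br sc L br"

abbreviation adjoint_coboundaries where
  "adjoint_coboundaries sc L br \<equiv> CE_coboundaries sc L br sc L br"


section \<open>The mass central extension of the conformal Galilei algebra\<close>

text \<open>
  The spin \<open>\<ell> \<in> 1/2 + \<nat>\<close> is parametrised by \<open>k :: nat\<close> via \<open>\<ell> = 1/2 + k\<close>; thus \<open>2\<ell> = 2k + 1\<close> and
  \<open>m + \<ell> + 1/2 = m + k + 1\<close>.
\<close>

definition ell :: "nat \<Rightarrow> complex" where
  "ell k = 1 / 2 + of_nat k"

abbreviation two_ell :: "nat \<Rightarrow> nat" where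
  "two_ell k \<equiv> 2 * k + 1"

datatype cga_gen = CC | DD | HH | Rot nat nat | PP nat nat | Mass

definition cga_basis :: "nat \<Rightarrow> nat \<Rightarrow> cga_gen set" where
  "cga_basis d k =
     {CC, DD, HH, Mass} \<union>
     {Rot i j | i j. 1 \<le> i \<and> i < j \<and> j \<le> d} \<union>
     {PP n i | n i. n \<le> two_ell k \<and> 1 \<le> i \<and> i \<le> d}"

text \<open>Elements are coordinate vectors with respect to this basis.\<close>

definition cga_carrier :: "nat \<Rightarrow> nat \<Rightarrow> (cga_gen \<Rightarrow> complex) set" where
  "cga_carrier d k = {x. \<forall>g. g \<notin> cga_basis d k \<longrightarrow> x g = 0}"

definition cga_scale :: "complex \<Rightarrow> (cga_gen \<Rightarrow> complex) \<Rightarrow> cga_gen \<Rightarrow> complex"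
  (infixr \<open>*\<^sub>C\<close> 75) where
  "c *\<^sub>C x = (\<lambda>g. c * x g)"

definition gen_vec :: "cga_gen \<Rightarrow> cga_gen \<Rightarrow> complex" where
  "gen_vec g = (\<lambda>h. if h = g then 1 else 0)"

text \<open>The convention \<open>M\<^sub>j\<^sub>i = - M\<^sub>i\<^sub>j\<close>, \<open>M\<^sub>i\<^sub>i = 0\<close>; only the \<open>Rot i j\<close> with \<open>i < j\<close> are basis elements.\<close>

definition rot :: "nat \<Rightarrow> nat \<Rightarrow> cga_gen \<Rightarrow> complex" where
  "rot i j = (if i < j then gen_vec (Rot i j) else if j < i then - gen_vec (Rot j i) else 0)"

definition kdelta :: "nat \<Rightarrow> nat \<Rightarrow> complex" where
  "kdelta i j = (if i = j then 1 else 0)"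

definition mass_coeff :: "nat \<Rightarrow> nat \<Rightarrow> complex" where
  "mass_coeff k m = (-1) ^ (m + k + 1) * fact (two_ell k - m) * fact m"

text \<open>
  Brackets of basis elements. At the ends of the \<open>P\<close>-ladder the out-of-range generator (or, by
  truncated subtraction, \<open>P\<^sub>0\<close>) occurs with coefficient \<open>0\<close>.
\<close>

fun gen_bracket :: "nat \<Rightarrow> cga_gen \<Rightarrow> cga_gen \<Rightarrow> cga_gen \<Rightarrow> complex" where
  "gen_bracket k (Rot i j) (Rot p r) =
     - (kdelta i p *\<^sub>C rot j r) - kdelta j r *\<^sub>C rot i p
     + kdelta i r *\<^sub>C rot j p + kdelta j p *\<^sub>C rot i r"
| "gen_bracket k DD HH = 2 *\<^sub>C gen_vec HH"
| "gen_bracket k HH DD = - (2 *\<^sub>C gen_vec HH)"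
| "gen_bracket k CC HH = gen_vec DD"
| "gen_bracket k HH CC = - gen_vec DD"
| "gen_bracket k DD CC = - (2 *\<^sub>C gen_vec CC)"
| "gen_bracket k CC DD = 2 *\<^sub>C gen_vec CC"
| "gen_bracket k (Rot i j) (PP n p) =
     - (kdelta i p *\<^sub>C gen_vec (PP n j)) + kdelta j p *\<^sub>C gen_vec (PP n i)"
| "gen_bracket k (PP n p) (Rot i j) =
     kdelta i p *\<^sub>C gen_vec (PP n j) - kdelta j p *\<^sub>C gen_vec (PP n i)"
| "gen_bracket k HH (PP n i) = - (of_nat n *\<^sub>C gen_vec (PP (n - 1) i))"
| "gen_bracket k (PP n i) HH = of_nat n *\<^sub>C gen_vec (PP (n - 1) i)"
| "gen_bracket k DD (PP n i) = (2 * (ell k - of_nat n)) *\<^sub>C gen_vec (PP n i)"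
| "gen_bracket k (PP n i) DD = - ((2 * (ell k - of_nat n)) *\<^sub>C gen_vec (PP n i))"
| "gen_bracket k CC (PP n i) = (2 * ell k - of_nat n) *\<^sub>C gen_vec (PP (n + 1) i)"
| "gen_bracket k (PP n i) CC = - ((2 * ell k - of_nat n) *\<^sub>C gen_vec (PP (n + 1) i))"
| "gen_bracket k (PP m i) (PP n j) =
     (kdelta i j * kdelta (m + n) (two_ell k) * mass_coeff k m) *\<^sub>C gen_vec Mass"
| "gen_bracket k _ _ = 0"

definition cga_bracket ::
  "nat \<Rightarrow> nat \<Rightarrow> (cga_gen \<Rightarrow> complex) \<Rightarrow> (cga_gen \<Rightarrow> complex) \<Rightarrow> cga_gen \<Rightarrow> complex" where
  "cga_bracket d k x y =
     (\<Sum>a \<in> cga_basis d k. \<Sum>b \<in> cga_basis d k. (x a * y b) *\<^sub>C gen_bracket k a b)"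

end

theory Submission
  imports Defs
begin

text \<open>
  Write the algebra as \<open>\<s> \<oplus> W \<oplus> \<complex> M\<close>, where \<open>\<s> = sl\<^sub>2 \<oplus> so(d)\<close> is spanned by \<open>C, D, H, M\<^sub>i\<^sub>j\<close>
  and \<open>W\<close> by the \<open>P\<^sub>n\<^sub>i\<close>. A 2-cocycle is brought to zero by three successive coboundaries.
  
  Averaging. A Hermitian form on the algebra is chosen for which the adjoint of \<open>ad x\<close>, for a
  generator \<open>x\<close> of \<open>\<s>\<close>, is a multiple of \<open>ad x'\<close> for a generator \<open>x'\<close> (\<open>H\<close> and \<open>C\<close> are swapped, up to
  sign). It induces a form on 2-cochains. Subtract from the cocycle its orthogonal projection to
  the coboundaries. By Cartan's formula the Lie derivative of the remainder \<open>F\<close> along \<open>x\<close> is a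
  coboundary, and it is also orthogonal to all coboundaries because these are stable under the
  adjoint derivative; hence it is \<open>0\<close> and \<open>F\<close> is \<open>\<s>\<close>-invariant (\<open>cohomologous_invariant\<close>). This
  replaces the Whitehead lemmas.
  
  Killing the \<open>\<s>\<close>-arguments. For an invariant cocycle and \<open>x, y \<in> \<s>\<close> the cocycle identity gives
  \<open>F([x, y], z) = [F(x, y), z]\<close> (\<open>invariant_cocycle_bracket\<close>). As \<open>\<s>\<close> is perfect (here \<open>d \<ge> 3\<close>
  enters for the first time), each \<open>F(x, -)\<close> is an inner derivation, and a second coboundary makes \<open>F(x, -) = 0\<close>
  for all \<open>x \<in> \<s>\<close> (\<open>relative_cocycle\<close>).
  
  Computing the rest. What remains is an \<open>\<s>\<close>-equivariant map on \<open>W \<oplus> \<complex> M\<close>. The eigenvalues of \<open>D\<close>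
  are odd on \<open>W\<close> and even on \<open>\<s> \<oplus> \<complex> M\<close>, because \<open>2\<ell>\<close> is odd. So \<open>F(P, M)\<close> is a multiple of \<open>P\<close>,
  and the cocycle identity forces the multiple to be \<open>0\<close> (\<open>G_PP_Mass\<close>); and \<open>F(P, P')\<close> lies in
  \<open>\<s> \<oplus> \<complex> M\<close>. In the latter, \<open>X = ad M\<^sub>i\<^sub>j\<close> satisfies \<open>X\<^sup>3 = - X\<close>, which excludes the
  traceless part symmetric in the two vector indices, where \<open>X\<close> would also have eigenvalues \<open>\<plusminus>2\<i>\<close>; the remaining parts
  are killed by the ladder relations of \<open>H\<close> and \<open>C\<close>, started in the middle of the ladder, where
  they vanish by (anti)symmetry. Only a multiple of the bracket
  \<open>W \<times> W \<rightarrow> \<complex> M\<close> survives (\<open>G_PP_PP\<close>), and it is the coboundary of a multiple of the projection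
  to \<open>\<complex> M\<close>.
\<close>

section \<open>Linear and alternating bilinear maps in coordinates\<close>

definition scal :: "complex \<Rightarrow> ('g \<Rightarrow> complex) \<Rightarrow> 'g \<Rightarrow> complex" where
  "scal c x = (\<lambda>g. c * x g)"

definition unit :: "'g \<Rightarrow> 'g \<Rightarrow> complex" where
  "unit a = (\<lambda>g. if g = a then 1 else 0)"

definition bil :: "'g set \<Rightarrow> ('g \<Rightarrow> 'g \<Rightarrow> 'h \<Rightarrow> complex) \<Rightarrow> ('g \<Rightarrow> complex) \<Rightarrow> ('g \<Rightarrow> complex) \<Rightarrow> 'h \<Rightarrow> complex" where
  "bil B N x y = (\<Sum>a\<in>B. \<Sum>b\<in>B. scal (x a * y b) (N a b))"

lemma sum_fun_apply: "(\<Sum>a\<in>A. f a) g = (\<Sum>a\<in>A. f a g)"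
  for f :: "'a \<Rightarrow> 'g \<Rightarrow> complex"
  by (induction A rule: infinite_finite_induct) auto

lemma scal_apply [simp]: "scal c x g = c * x g"
  by (simp add: scal_def)

lemma scal_zero_left [simp]: "scal 0 x = 0"
  and scal_zero_right [simp]: "scal c 0 = 0"
  and scal_one [simp]: "scal 1 x = x"
  and scal_scal [simp]: "scal c (scal c' x) = scal (c * c') x"
  and scal_minus_left: "scal (- c) x = - scal c x"
  and scal_minus_right: "scal c (- x) = - scal c x"
  and scal_add_right: "scal c (x + y) = scal c x + scal c y"
  and scal_add_left: "scal (c + c') x = scal c x + scal c' x"
  and scal_diff_right: "scal c (x - y) = scal c x - scal c y"
  by (auto simp: fun_eq_iff algebra_simps)

lemma scal_sum_right: "scal c (\<Sum>a\<in>A. f a) = (\<Sum>a\<in>A. scal c (f a))"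
  by (auto simp: fun_eq_iff sum_fun_apply sum_distrib_left)

lemma unit_apply: "unit a g = (if g = a then 1 else 0)"
  by (simp add: unit_def)

lemmas pointwise = plus_fun_apply zero_fun_apply minus_apply uminus_apply scal_apply

text \<open>Equations between vectors are to be kept apart from equations between their coordinates.\<close>

declare pointwise [simp del]

locale based_space =
  fixes B :: "'g set"
  assumes finite_B [simp]: "finite B"
begin

definition carrier :: "('g \<Rightarrow> complex) set" where
  "carrier = {x. \<forall>g. g \<notin> B \<longrightarrow> x g = 0}"

definition proj :: "('g \<Rightarrow> complex) \<Rightarrow> 'g \<Rightarrow> complex" where
  "proj x = (\<lambda>g. if g \<in> B then x g else 0)"

text \<open>
  Linear maps of the carrier into itself, extended to all coordinate vectors by ignoring
  coordinates outside \<open>B\<close>. With this convention identities hold for all vectors, free of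
  membership conditions.
\<close>

definition endo :: "(('g \<Rightarrow> complex) \<Rightarrow> 'g \<Rightarrow> complex) \<Rightarrow> bool" where
  "endo \<phi> \<longleftrightarrow> (\<forall>x y. \<phi> (x + y) = \<phi> x + \<phi> y) \<and> (\<forall>c x. \<phi> (scal c x) = scal c (\<phi> x)) \<and>
     (\<forall>x. \<phi> (proj x) = \<phi> x) \<and> (\<forall>x. \<phi> x \<in> carrier)"

lemma proj_carrier [simp]: "proj x \<in> carrier"
  by (simp add: proj_def carrier_def)

lemma proj_id: "x \<in> carrier \<Longrightarrow> proj x = x"
  by (auto simp: proj_def carrier_def fun_eq_iff)

lemma proj_add: "proj (x + y) = proj x + proj y"
  and proj_scal: "proj (scal c x) = scal c (proj x)"
  by (auto simp: proj_def fun_eq_iff pointwise)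

lemma proj_expand: "proj x = (\<Sum>a\<in>B. scal (x a) (unit a))"
  by (auto simp: pointwise proj_def fun_eq_iff sum_fun_apply unit_apply if_distrib cong: if_cong)

lemma carrier_zero [simp]: "0 \<in> carrier"
  and carrier_add: "x \<in> carrier \<Longrightarrow> y \<in> carrier \<Longrightarrow> x + y \<in> carrier"
  and carrier_minus: "x \<in> carrier \<Longrightarrow> - x \<in> carrier"
  and carrier_diff: "x \<in> carrier \<Longrightarrow> y \<in> carrier \<Longrightarrow> x - y \<in> carrier"
  and carrier_scal: "x \<in> carrier \<Longrightarrow> scal c x \<in> carrier"
  and carrier_unit [simp]: "a \<in> B \<Longrightarrow> unit a \<in> carrier"
  by (auto simp: carrier_def unit_apply pointwise)

lemma carrier_sum: "(\<And>a. a \<in> A \<Longrightarrow> f a \<in> carrier) \<Longrightarrow> (\<Sum>a\<in>A. f a) \<in> carrier"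
  by (induction A rule: infinite_finite_induct) (auto intro: carrier_add)

lemma endoD:
  assumes "endo \<phi>"
  shows "\<phi> (x + y) = \<phi> x + \<phi> y" "\<phi> (scal c x) = scal c (\<phi> x)" "\<phi> (proj x) = \<phi> x" "\<phi> x \<in> carrier"
    "\<phi> 0 = 0" "\<phi> (- x) = - \<phi> x" "\<phi> (x - y) = \<phi> x - \<phi> y"
proof -
  show add: "\<phi> (x + y) = \<phi> x + \<phi> y" for x y using assms by (simp add: endo_def)
  show sc: "\<phi> (scal c x) = scal c (\<phi> x)" for c x using assms by (simp add: endo_def)
  show "\<phi> (proj x) = \<phi> x" "\<phi> x \<in> carrier" using assms by (auto simp: endo_def)
  show z: "\<phi> 0 = 0" using sc[of 0 0] by simp
  show m: "\<phi> (- x) = - \<phi> x" for x using sc[of "-1" x] by (simp add: scal_minus_left)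
  show "\<phi> (x - y) = \<phi> x - \<phi> y" using add[of x "-y"] m[of y] by simp
qed

lemma endo_sum: assumes "endo \<phi>" shows "\<phi> (\<Sum>a\<in>A. f a) = (\<Sum>a\<in>A. \<phi> (f a))"
  by (induction A rule: infinite_finite_induct) (simp_all add: endoD(1)[OF assms] endoD(5)[OF assms])

lemma endo_expand:
  assumes "endo \<phi>" shows "\<phi> x = (\<Sum>a\<in>B. scal (x a) (\<phi> (unit a)))"
proof -
  have "\<phi> x = \<phi> (\<Sum>a\<in>B. scal (x a) (unit a))"
    using endoD(3)[OF assms, of x] by (simp add: proj_expand)
  then show ?thesis by (simp only: endo_sum[OF assms] endoD(2)[OF assms])
qed

lemma endo_eqI:
  assumes "endo \<phi>" "endo \<psi>" "\<And>a. a \<in> B \<Longrightarrow> \<phi> (unit a) = \<psi> (unit a)"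
  shows "\<phi> x = \<psi> x"
  using endo_expand[OF assms(1), of x] endo_expand[OF assms(2), of x] assms(3) by simp

lemma endo_zero: "endo (\<lambda>x. 0)"
  and endo_add: "endo \<phi> \<Longrightarrow> endo \<psi> \<Longrightarrow> endo (\<lambda>x. \<phi> x + \<psi> x)"
  and endo_diff: "endo \<phi> \<Longrightarrow> endo \<psi> \<Longrightarrow> endo (\<lambda>x. \<phi> x - \<psi> x)"
  and endo_minus: "endo \<phi> \<Longrightarrow> endo (\<lambda>x. - \<phi> x)"
  and endo_scal: "endo \<phi> \<Longrightarrow> endo (\<lambda>x. scal c (\<phi> x))"
  by (auto simp: endo_def fun_eq_iff carrier_def pointwise algebra_simps)

lemma endo_comp: "endo \<phi> \<Longrightarrow> endo \<psi> \<Longrightarrow> endo (\<lambda>x. \<phi> (\<psi> x))"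
  by (auto simp: endo_def)

lemma endo_sumI: "(\<And>i. i \<in> I \<Longrightarrow> endo (\<phi> i)) \<Longrightarrow> endo (\<lambda>x. \<Sum>i\<in>I. \<phi> i x)"
  by (induction I rule: infinite_finite_induct) (auto intro: endo_zero endo_add)

text \<open>
  For \<open>v\<close> a unit vector these are the matrix units, which span the 1-cochains.
\<close>

definition elem :: "'g \<Rightarrow> ('g \<Rightarrow> complex) \<Rightarrow> ('g \<Rightarrow> complex) \<Rightarrow> 'g \<Rightarrow> complex" where
  "elem a v x = scal (x a) v"

lemma endo_elem: "a \<in> B \<Longrightarrow> v \<in> carrier \<Longrightarrow> endo (elem a v)"
  by (auto simp: endo_def elem_def proj_def carrier_def fun_eq_iff pointwise algebra_simps)

lemma endo_extend:
  assumes "\<And>a. a \<in> B \<Longrightarrow> f a \<in> carrier"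
  obtains \<phi> where "endo \<phi>" "\<And>a. a \<in> B \<Longrightarrow> \<phi> (unit a) = f a"
proof
  let ?\<phi> = "\<lambda>x. \<Sum>a\<in>B. elem a (f a) x"
  show "endo ?\<phi>" by (intro endo_sumI endo_elem assms)
  fix a assume a: "a \<in> B"
  have "?\<phi> (unit a) = (\<Sum>b\<in>B. if b = a then f b else 0)"
    by (intro sum.cong refl) (auto simp: elem_def unit_apply)
  then show "?\<phi> (unit a) = f a" using a by simp
qed

lemma carrier_induct [consumes 1, case_names zero add scal unit]:
  assumes v: "v \<in> carrier" and zero: "P 0"
    and add: "\<And>x y. x \<in> carrier \<Longrightarrow> y \<in> carrier \<Longrightarrow> P x \<Longrightarrow> P y \<Longrightarrow> P (x + y)"
    and scal: "\<And>c x. x \<in> carrier \<Longrightarrow> P x \<Longrightarrow> P (scal c x)"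
    and unit: "\<And>a. a \<in> B \<Longrightarrow> P (unit a)"
  shows "P v"
proof -
  have "P (\<Sum>a\<in>A. scal (v a) (unit a)) \<and> (\<Sum>a\<in>A. scal (v a) (unit a)) \<in> carrier" if "finite A" "A \<subseteq> B" for A
    using that
    by (induction A rule: finite_induct) (auto intro!: zero add scal unit carrier_add carrier_scal)
  from this[OF finite_B] show ?thesis
    using proj_id[OF v] by (simp add: proj_expand)
qed

text \<open>
  Antisymmetry is used in place of \<open>F x x = 0\<close>; over the complex numbers both say the same, and
  antisymmetry makes linearity in one argument enough.
\<close>

definition alt2 :: "(('g \<Rightarrow> complex) \<Rightarrow> ('g \<Rightarrow> complex) \<Rightarrow> 'g \<Rightarrow> complex) \<Rightarrow> bool" where
  "alt2 F \<longleftrightarrow> (\<forall>x. endo (F x)) \<and> (\<forall>x y. F x y = - F y x)"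

lemma alt2_right: "alt2 F \<Longrightarrow> endo (F x)"
  by (simp add: alt2_def)

lemma alt2_anti: "alt2 F \<Longrightarrow> F x y = - F y x"
  unfolding alt2_def by blast

lemma alt2_left: assumes "alt2 F" shows "endo (\<lambda>x. F x y)"
proof -
  have "(\<lambda>x. F x y) = (\<lambda>x. - F y x)" using alt2_anti[OF assms] by blast
  then show ?thesis using endo_minus[OF alt2_right[OF assms]] by simp
qed

lemmas alt2D = endoD[OF alt2_right] endoD[OF alt2_left]

lemma alt2_self: assumes "alt2 F" shows "F x x = 0"
proof
  fix g
  have "F x x g = - F x x g" using alt2_anti[OF assms, of x x] by (metis uminus_apply)
  then show "F x x g = 0 g" by (simp add: pointwise)
qed

lemma alt2_zero: "alt2 (\<lambda>x y. 0)"
  by (simp add: alt2_def endo_zero)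

lemma alt2_diff:
  assumes F: "alt2 F" and G: "alt2 G" shows "alt2 (\<lambda>x y. F x y - G x y)"
  unfolding alt2_def
proof (intro conjI allI)
  show "endo (\<lambda>y. F x y - G x y)" for x
    by (rule endo_diff[OF alt2_right[OF F] alt2_right[OF G]])
  show "F x y - G x y = - (F y x - G y x)" for x y
    by (subst alt2_anti[OF F], subst alt2_anti[OF G]) (rule ext, simp add: pointwise)
qed

lemma alt2_eqI:
  assumes F: "alt2 F" and G: "alt2 G"
    and eq: "\<And>a b. a \<in> B \<Longrightarrow> b \<in> B \<Longrightarrow> F (unit a) (unit b) = G (unit a) (unit b)"
  shows "F x y = G x y"
proof -
  have "F (unit a) y = G (unit a) y" if "a \<in> B" for a
    by (rule endo_eqI[OF alt2_right[OF F] alt2_right[OF G]]) (use that eq in auto)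
  then show ?thesis
    by (rule endo_eqI[OF alt2_left[OF F] alt2_left[OF G]])
qed

end

section \<open>Low-degree cohomology of a Lie algebra with structure constants\<close>

locale based_algebra = based_space B for B :: "'g set" +
  fixes N :: "'g \<Rightarrow> 'g \<Rightarrow> 'g \<Rightarrow> complex"
  assumes N_carrier: "\<And>a b. a \<in> B \<Longrightarrow> b \<in> B \<Longrightarrow> N a b \<in> carrier"
    and N_anti: "\<And>a b. a \<in> B \<Longrightarrow> b \<in> B \<Longrightarrow> N a b = - N b a"
begin

abbreviation br where "br \<equiv> bil B N"

lemma endo_br: "endo (br x)"
  unfolding endo_def
proof (intro conjI allI)
  show "br x (y + z) = br x y + br x z" for y z
    by (simp add: bil_def fun_eq_iff sum_fun_apply pointwise algebra_simps sum.distrib)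
  show "br x (scal c y) = scal c (br x y)" for c y
    by (simp add: bil_def fun_eq_iff sum_fun_apply pointwise algebra_simps sum_distrib_left)
  show "br x (proj y) = br x y" for y
    by (simp add: bil_def proj_def cong: sum.cong)
  show "br x y \<in> carrier" for y
    unfolding bil_def by (intro carrier_sum carrier_scal N_carrier)
qed

lemma br_anti: "br x y = - br y x"
proof -
  have "br y x = (\<Sum>a\<in>B. \<Sum>b\<in>B. scal (x a * y b) (N b a))"
    unfolding bil_def by (subst sum.swap) (simp add: mult.commute)
  also have "\<dots> = (\<Sum>a\<in>B. \<Sum>b\<in>B. - scal (x a * y b) (N a b))"
    by (intro sum.cong refl) (metis N_anti scal_minus_right)
  also have "\<dots> = - br x y" by (simp add: bil_def sum_negf)
  finally show ?thesis by simp
qed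

lemma alt2_br: "alt2 br"
  unfolding alt2_def using endo_br br_anti by blast

lemmas brD = alt2D[OF alt2_br]

lemma br_carrier [simp]: "br x y \<in> carrier"
  by (rule brD)

lemma br_unit [simp]: "a \<in> B \<Longrightarrow> b \<in> B \<Longrightarrow> br (unit a) (unit b) = N a b"
proof -
  assume ab: "a \<in> B" "b \<in> B"
  have "br (unit a) (unit b) = (\<Sum>a'\<in>B. \<Sum>b'\<in>B. if b' = b then if a' = a then N a b else 0 else 0)"
    unfolding bil_def by (intro sum.cong refl) (auto simp: unit_apply)
  with ab show ?thesis by simp
qed

lemma br_unit_coord:
  assumes "a \<in> B" shows "br (unit a) v c = (\<Sum>b\<in>B. v b * N a b c)"
proof -
  have "br (unit a) v = (\<Sum>b\<in>B. scal (v b) (br (unit a) (unit b)))"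
    by (rule endo_expand[OF endo_br])
  with assms show ?thesis by (simp add: sum_fun_apply pointwise)
qed

end

locale based_lie_algebra = based_algebra B N for B :: "'g set" and N +
  assumes N_jacobi: "\<And>a b c. a \<in> B \<Longrightarrow> b \<in> B \<Longrightarrow> c \<in> B \<Longrightarrow>
      br (unit a) (N b c) + br (unit b) (N c a) + br (unit c) (N a b) = 0"
begin

lemma jacobi: "br x (br y z) + br y (br z x) + br z (br x y) = 0"
proof -
  note ei = endo_add endo_comp[OF endo_br] endo_comp[OF alt2_left[OF alt2_br]] endo_br alt2_left[OF alt2_br]
  
  have 1: "br (unit a) (br (unit b) (unit c)) + br (unit b) (br (unit c) (unit a)) + br (unit c) (br (unit a) (unit b)) = 0"
    if "a \<in> B" "b \<in> B" "c \<in> B" for a b c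
    using that N_jacobi by simp
  have 2: "br (unit a) (br (unit b) z) + br (unit b) (br z (unit a)) + br z (br (unit a) (unit b)) = 0"
    if "a \<in> B" "b \<in> B" for a b
    by (rule endo_eqI[OF _ endo_zero, where x = z]) (intro ei, rule 1[OF that])
  have 3: "br (unit a) (br y z) + br y (br z (unit a)) + br z (br (unit a) y) = 0"
    if "a \<in> B" for a
    by (rule endo_eqI[OF _ endo_zero, where x = y]) (intro ei, rule 2[OF that])
  show ?thesis
    by (rule endo_eqI[OF _ endo_zero, where x = x]) (intro ei, rule 3)
qed

lemma br_br: "br (br x y) z = br x (br y z) - br y (br x z)"
proof -
  have 1: "br y (br z x) = - br y (br x z)"
    using brD(6)[of y "br x z"] br_anti[of z x] by simp
  have "br x (br y z) - br y (br x z) + br z (br x y) = 0"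
    using jacobi[of x y z] unfolding 1 by simp
  then have "br x (br y z) - br y (br x z) = - br z (br x y)"
    by (simp only: eq_neg_iff_add_eq_0)
  then show ?thesis using br_anti[of "br x y" z] by simp
qed

text \<open>
  \<open>cob\<close> is the Chevalley--Eilenberg differential on 1-cochains with adjoint coefficients, and
  \<open>Lie1\<close>, \<open>Lie2\<close> are the Lie derivatives along \<open>x\<close> of 1- and 2-cochains.
\<close>

definition cob where
  "cob \<phi> x y = br x (\<phi> y) - br y (\<phi> x) - \<phi> (br x y)"

definition cocycle where
  "cocycle F \<longleftrightarrow> alt2 F \<and> (\<forall>x y z. br x (F y z) - br y (F x z) + br z (F x y)
     - F (br x y) z + F (br x z) y - F (br y z) x = 0)"

definition Lie1 where
  "Lie1 x \<phi> y = br x (\<phi> y) - \<phi> (br x y)"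

definition Lie2 where
  "Lie2 x F y z = br x (F y z) - F (br x y) z - F y (br x z)"

lemma endo_cob: assumes "endo \<phi>" shows "endo (cob \<phi> x)"
  unfolding cob_def
  by (rule endo_diff[OF endo_diff[OF endo_comp[OF endo_br assms] alt2_left[OF alt2_br]]
        endo_comp[OF assms endo_br]])

lemma alt2_cob: "endo \<phi> \<Longrightarrow> alt2 (cob \<phi>)"
  unfolding alt2_def
proof (intro conjI allI)
  fix x y assume e: "endo \<phi>"
  show "cob \<phi> x y = - cob \<phi> y x"
    using endoD(6)[OF e, of "br y x"] br_anti[of x y] by (simp add: cob_def)
qed (rule endo_cob)

lemma cocycle_cob:
  assumes e: "endo \<phi>" shows "cocycle (cob \<phi>)"
  unfolding cocycle_def
proof (intro conjI allI)
  show "alt2 (cob \<phi>)" by (rule alt2_cob[OF e])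
  fix x y z
  have J': "\<phi> (br (br x y) z) = \<phi> (br (br x z) y) - \<phi> (br (br y z) x)"
  proof -
    have "br (br x y) z = br (br x z) y - br (br y z) x"
      using br_br[of x y z] br_anti[of "br x z" y] br_anti[of "br y z" x] by simp
    then show ?thesis by (simp only: endoD(7)[OF e])
  qed
  show "br x (cob \<phi> y z) - br y (cob \<phi> x z) + br z (cob \<phi> x y)
     - cob \<phi> (br x y) z + cob \<phi> (br x z) y - cob \<phi> (br y z) x = 0"
    by (simp add: cob_def brD(1,7) br_br[of _ _ "\<phi> _"] J' algebra_simps)
qed

lemma cocycle_alt2: "cocycle F \<Longrightarrow> alt2 F"
  by (simp add: cocycle_def)

lemma cocycle_eq: "cocycle F \<Longrightarrow> br x (F y z) - br y (F x z) + br z (F x y)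
     - F (br x y) z + F (br x z) y - F (br y z) x = 0"
  by (simp add: cocycle_def)

lemma cocycle_diff: assumes "cocycle F" "cocycle G" shows "cocycle (\<lambda>x y. F x y - G x y)"
  unfolding cocycle_def
proof (intro conjI allI)
  show "alt2 (\<lambda>x y. F x y - G x y)"
    by (intro alt2_diff cocycle_alt2 assms)
  fix x y z
  show "br x (F y z - G y z) - br y (F x z - G x z) + br z (F x y - G x y) - (F (br x y) z - G (br x y) z) +
       (F (br x z) y - G (br x z) y) - (F (br y z) x - G (br y z) x) = 0"
    (is "?l = 0")
  proof -
    have "?l = (br x (F y z) - br y (F x z) + br z (F x y) - F (br x y) z + F (br x z) y - F (br y z) x)
      - (br x (G y z) - br y (G x z) + br z (G x y) - G (br x y) z + G (br x z) y - G (br y z) x)"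
      by (simp only: brD(7)) (simp add: algebra_simps)
    also have "\<dots> = 0" by (simp only: cocycle_eq[OF assms(1)] cocycle_eq[OF assms(2)] diff_zero)
    finally show ?thesis .
  qed
qed

lemma endo_Lie1: assumes "endo \<phi>" shows "endo (Lie1 x \<phi>)"
  unfolding Lie1_def by (rule endo_diff[OF endo_comp[OF endo_br assms] endo_comp[OF assms endo_br]])

lemma Lie2_cob: assumes e: "endo \<phi>" shows "Lie2 x (cob \<phi>) y z = cob (Lie1 x \<phi>) y z"
  unfolding Lie2_def cob_def Lie1_def
  by (simp only: brD(7) endoD(7)[OF e] br_br endoD(1)[OF e]) (rule ext, simp add: pointwise)

text \<open>
  Cartan's formula \<open>L\<^sub>x = d i\<^sub>x + i\<^sub>x d\<close> on a cocycle, where the second term vanishes.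
\<close>

lemma Lie2_cocycle: assumes c: "cocycle F" shows "Lie2 x F y z = cob (F x) y z"
proof -
  note F = cocycle_alt2[OF c]
  have "Lie2 x F y z - cob (F x) y z = br x (F y z) - br y (F x z) + br z (F x y)
     - F (br x y) z + F (br x z) y - F (br y z) x"
    unfolding Lie2_def cob_def alt2_anti[OF F, of y "br x z"] alt2_anti[OF F, of x "br y z"]
    by (rule ext) (simp add: pointwise)
  also have "\<dots> = 0" by (rule cocycle_eq[OF c])
  finally show ?thesis by simp
qed

end

section \<open>Averaging by orthogonal projection\<close>

definition herm :: "'t set \<Rightarrow> ('t \<Rightarrow> real) \<Rightarrow> ('t \<Rightarrow> complex) \<Rightarrow> ('t \<Rightarrow> complex) \<Rightarrow> complex" where
  "herm I w u v = (\<Sum>t\<in>I. of_real (w t) * u t * cnj (v t))"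

lemma herm_diff_left: "herm I w (\<lambda>t. u t - u' t) v = herm I w u v - herm I w u' v"
  by (simp add: herm_def algebra_simps sum_subtractf)

lemma herm_scale_left: "herm I w (\<lambda>t. c * u t) v = c * herm I w u v"
  by (simp add: herm_def algebra_simps sum_distrib_left)

lemma herm_sum_right: "herm I w u (\<lambda>t. \<Sum>i\<in>J. c i * v i t) = (\<Sum>i\<in>J. cnj (c i) * herm I w u (v i))"
  unfolding herm_def sum_distrib_left cnj_sum
  by (subst sum.swap) (simp add: algebra_simps)

lemma herm_add_right: "herm I w u (\<lambda>t. v t + v' t) = herm I w u v + herm I w u v'"
  by (simp add: herm_def algebra_simps sum.distrib)

lemma herm_self_zero:
  assumes "finite I" "\<And>t. t \<in> I \<Longrightarrow> w t > 0" "herm I w u u = 0" "t \<in> I"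
  shows "u t = 0"
proof -
  have "herm I w u u = of_real (\<Sum>t\<in>I. w t * (cmod (u t))\<^sup>2)"
    by (simp add: herm_def mult.assoc complex_norm_square[symmetric])
  with assms(3) have "(\<Sum>t\<in>I. w t * (cmod (u t))\<^sup>2) = 0"
    by (metis of_real_eq_0_iff)
  then have "\<forall>t\<in>I. w t * (cmod (u t))\<^sup>2 = 0"
    using assms(1) less_imp_le[OF assms(2)] by (subst (asm) sum_nonneg_eq_0_iff) auto
  with assms(2,4) show ?thesis by force
qed

text \<open>
  Orthogonal projection to the span of finitely many vectors, by Gram--Schmidt: if \<open>\<rho>\<close> is the
  residual of the new vector \<open>T k\<close> modulo the old ones, then the residual of \<open>u\<close> modulo the old ones
  is corrected by a multiple of \<open>\<rho>\<close>, which does not disturb the orthogonality already reached.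
\<close>

lemma orthogonal_residual:
  assumes J: "finite J" and I: "finite I" and w: "\<And>t. t \<in> I \<Longrightarrow> w t > 0"
  shows "\<exists>c. \<forall>j\<in>J. herm I w (\<lambda>t. u t - (\<Sum>i\<in>J. c i * T i t)) (T j) = 0"
  using J
proof (induction J arbitrary: u rule: finite_induct)
  case empty
  then show ?case by simp
next
  case (insert k J)
  obtain c where c: "\<forall>j\<in>J. herm I w (\<lambda>t. u t - (\<Sum>i\<in>J. c i * T i t)) (T j) = 0"
    using insert.IH by blast
  obtain m where m: "\<forall>j\<in>J. herm I w (\<lambda>t. T k t - (\<Sum>i\<in>J. m i * T i t)) (T j) = 0"
    using insert.IH[of "T k"] by blast
  define r where "r = (\<lambda>t. u t - (\<Sum>i\<in>J. c i * T i t))"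
  define \<rho> where "\<rho> = (\<lambda>t. T k t - (\<Sum>i\<in>J. m i * T i t))"
  \<comment> \<open>If \<open>\<rho>\<close> has norm zero then \<open>\<alpha> = 0\<close> by division by zero, and no correction is made.\<close>
  define \<alpha> where "\<alpha> = herm I w r \<rho> / herm I w \<rho> \<rho>"
  define c' where "c' i = (if i = k then \<alpha> else c i - \<alpha> * m i)" for i
  have res: "(\<lambda>t. u t - (\<Sum>i\<in>insert k J. c' i * T i t)) = (\<lambda>t. r t - \<alpha> * \<rho> t)"
  proof
    fix t
    have "(\<Sum>i\<in>J. c' i * T i t) = (\<Sum>i\<in>J. (c i - \<alpha> * m i) * T i t)"
      by (rule sum.cong) (use insert.hyps in \<open>auto simp: c'_def\<close>)
    then show "u t - (\<Sum>i\<in>insert k J. c' i * T i t) = r t - \<alpha> * \<rho> t"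
      using insert.hyps
      by (simp add: r_def \<rho>_def c'_def algebra_simps sum_subtractf sum_distrib_left)
  qed
  have J: "herm I w (\<lambda>t. r t - \<alpha> * \<rho> t) (T j) = 0" if "j \<in> J" for j
    using c m that by (simp add: herm_diff_left herm_scale_left r_def \<rho>_def)
  have \<rho>: "herm I w (\<lambda>t. r t - \<alpha> * \<rho> t) \<rho> = 0"
  proof (cases "herm I w \<rho> \<rho> = 0")
    case True
    then have "\<And>t. t \<in> I \<Longrightarrow> \<rho> t = 0"
      using herm_self_zero[of I w \<rho>] I w by blast
    then show ?thesis by (simp add: herm_def)
  next
    case False
    then show ?thesis by (simp only: herm_diff_left herm_scale_left) (simp add: \<alpha>_def)
  qed
  have Tk: "T k = (\<lambda>t. \<rho> t + (\<Sum>i\<in>J. m i * T i t))"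
    by (simp add: \<rho>_def)
  have k: "herm I w (\<lambda>t. r t - \<alpha> * \<rho> t) (T k) = 0"
    unfolding Tk herm_add_right herm_sum_right \<rho> using J by simp
  have "\<forall>j\<in>insert k J. herm I w (\<lambda>t. u t - (\<Sum>i\<in>insert k J. c' i * T i t)) (T j) = 0"
    unfolding res using J k by blast
  then show ?case by blast
qed

context based_lie_algebra
begin

lemma cob_diff: "cob (\<lambda>x. \<phi> x - \<psi> x) x y = cob \<phi> x y - cob \<psi> x y"
  by (simp only: cob_def brD(7)) (rule ext, simp add: pointwise)

lemma cob_add: "cob (\<lambda>x. \<phi> x + \<psi> x) x y = cob \<phi> x y + cob \<psi> x y"
  by (simp only: cob_def brD(1)) (rule ext, simp add: pointwise)

lemma cob_lincomb:
  "cob (\<lambda>x. \<Sum>i\<in>I. scal (c i) (\<phi> i x)) x y = (\<Sum>i\<in>I. scal (c i) (cob (\<phi> i) x y))"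
  by (simp add: cob_def endo_sum[OF endo_br] brD(2) scal_diff_right sum_subtractf)

definition coords where
  "coords F = (\<lambda>(a, b, c). F (unit a) (unit b) c)"

text \<open>
  The form on 2-cochains induced by a form on the algebra for which the basis is orthogonal and
  \<open>a\<close> has squared length \<open>w a\<close>: arguments contribute the dual weights.
\<close>

definition form :: "('g \<Rightarrow> real) \<Rightarrow> _" where
  "form w F G = herm (B \<times> B \<times> B) (\<lambda>(a, b, c). w c / (w a * w b)) (coords F) (coords G)"

lemma form_nested: "form w F G = (\<Sum>a\<in>B. \<Sum>b\<in>B. \<Sum>c\<in>B. of_real (w c / (w a * w b)) *
    F (unit a) (unit b) c * cnj (G (unit a) (unit b) c))"
  unfolding form_def herm_def coords_def by (simp add: sum.cartesian_product split_def)

lemma Lie2_coord: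
  assumes F: "alt2 F" and s: "s \<in> B" "a \<in> B" "b \<in> B"
  shows "Lie2 (unit s) F (unit a) (unit b) c =
    (\<Sum>t\<in>B. F (unit a) (unit b) t * N s t c) - (\<Sum>t\<in>B. N s a t * F (unit t) (unit b) c)
    - (\<Sum>t\<in>B. N s b t * F (unit a) (unit t) c)"
proof -
  have 1: "F (br (unit s) (unit a)) (unit b) c = (\<Sum>t\<in>B. N s a t * F (unit t) (unit b) c)"
    using endo_expand[OF alt2_left[OF F], of "N s a" "unit b"] s by (simp add: sum_fun_apply pointwise)
  have 2: "F (unit a) (br (unit s) (unit b)) c = (\<Sum>t\<in>B. N s b t * F (unit a) (unit t) c)"
    using endo_expand[OF alt2_right[OF F], of "unit a" "N s b"] s by (simp add: sum_fun_apply pointwise)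
  show ?thesis
    unfolding Lie2_def pointwise 1 2 using s by (simp add: br_unit_coord)
qed

text \<open>
  If \<open>ad s'\<close> is adjoint to \<open>ad s\<close> on the algebra, up to the factor \<open>\<sigma>\<close>, then the same holds for the
  Lie derivatives of 2-cochains. A Lie derivative is a sum of three terms, one acting on the value
  and one on each argument, and for each of them the assumption moves the structure constant
  to the other side of the form.
\<close>

lemma form_Lie2_adjoint:
  assumes w: "\<And>a. a \<in> B \<Longrightarrow> w a > 0" and s: "s \<in> B" "s' \<in> B"
    and adj: "\<And>a c. a \<in> B \<Longrightarrow> c \<in> B \<Longrightarrow> N s a c * of_real (w c) = \<sigma> * cnj (N s' c a) * of_real (w a)"
    and F: "alt2 F" and G: "alt2 G"
  shows "form w (Lie2 (unit s) F) G = \<sigma> * form w F (Lie2 (unit s') G)"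
proof -
  define f where "f a b c = F (unit a) (unit b) c" for a b c
  define g where "g a b c = cnj (G (unit a) (unit b) c)" for a b c
  define W where "W a b c = complex_of_real (w c / (w a * w b))" for a b c
  have up: "W a b c * N s t c = \<sigma> * W a b t * cnj (N s' c t)" if "a \<in> B" "b \<in> B" "c \<in> B" "t \<in> B" for a b c t
    using adj[of t c] that by (simp add: W_def field_simps)
  have dn1: "W a b c * N s a t = \<sigma> * W t b c * cnj (N s' t a)" if "a \<in> B" "b \<in> B" "c \<in> B" "t \<in> B" for a b c t
    using adj[of a t] w[of a] w[of t] w[of b] that by (simp add: W_def field_simps)
  have dn2: "W a b c * N s b t = \<sigma> * W a t c * cnj (N s' t b)" if "a \<in> B" "b \<in> B" "c \<in> B" "t \<in> B" for a b c t
    using adj[of b t] w[of b] w[of t] w[of a] that by (simp add: W_def field_simps)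
  have 1: "(\<Sum>a\<in>B. \<Sum>b\<in>B. \<Sum>c\<in>B. \<Sum>t\<in>B. W a b c * (f a b t * N s t c) * g a b c)
     = (\<Sum>a\<in>B. \<Sum>b\<in>B. \<Sum>c\<in>B. \<Sum>t\<in>B. \<sigma> * (W a b c * f a b c * (g a b t * cnj (N s' t c))))"
  proof (rule sum.cong[OF refl], rule sum.cong[OF refl])
    fix a b assume ab: "a \<in> B" "b \<in> B"
    have "(\<Sum>c\<in>B. \<Sum>t\<in>B. W a b c * (f a b t * N s t c) * g a b c)
      = (\<Sum>c\<in>B. \<Sum>t\<in>B. \<sigma> * (W a b t * f a b t * (g a b c * cnj (N s' c t))))"
    proof (intro sum.cong refl)
      fix c t assume "c \<in> B" "t \<in> B"
      have "W a b c * (f a b t * N s t c) * g a b c = (W a b c * N s t c) * f a b t * g a b c" by simp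
      also have "\<dots> = \<sigma> * (W a b t * f a b t * (g a b c * cnj (N s' c t)))"
        by (subst up[OF ab \<open>c \<in> B\<close> \<open>t \<in> B\<close>]) simp
      finally show "W a b c * (f a b t * N s t c) * g a b c = \<sigma> * (W a b t * f a b t * (g a b c * cnj (N s' c t)))" .
    qed
    also have "\<dots> = (\<Sum>c\<in>B. \<Sum>t\<in>B. \<sigma> * (W a b c * f a b c * (g a b t * cnj (N s' t c))))"
      by (rule sum.swap)
    finally show "(\<Sum>c\<in>B. \<Sum>t\<in>B. W a b c * (f a b t * N s t c) * g a b c) = \<dots>" .
  qed
  have 2: "(\<Sum>a\<in>B. \<Sum>b\<in>B. \<Sum>c\<in>B. \<Sum>t\<in>B. W a b c * (N s a t * f t b c) * g a b c)
     = (\<Sum>a\<in>B. \<Sum>b\<in>B. \<Sum>c\<in>B. \<Sum>t\<in>B. \<sigma> * (W a b c * f a b c * (cnj (N s' a t) * g t b c)))"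
  proof -
    have "(\<Sum>a\<in>B. \<Sum>b\<in>B. \<Sum>c\<in>B. \<Sum>t\<in>B. W a b c * (N s a t * f t b c) * g a b c)
      = (\<Sum>a\<in>B. \<Sum>b\<in>B. \<Sum>c\<in>B. \<Sum>t\<in>B. \<sigma> * (W t b c * f t b c * (cnj (N s' t a) * g a b c)))"
    proof (intro sum.cong refl)
      fix a b c t assume *: "a \<in> B" "b \<in> B" "c \<in> B" "t \<in> B"
      have "W a b c * (N s a t * f t b c) * g a b c = (W a b c * N s a t) * f t b c * g a b c" by simp
      also have "\<dots> = \<sigma> * (W t b c * f t b c * (cnj (N s' t a) * g a b c))"
        by (subst dn1[OF *]) simp
      finally show "W a b c * (N s a t * f t b c) * g a b c = \<sigma> * (W t b c * f t b c * (cnj (N s' t a) * g a b c))" .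
    qed
    also have "\<dots> = (\<Sum>b\<in>B. \<Sum>c\<in>B. \<Sum>a\<in>B. \<Sum>t\<in>B. \<sigma> * (W t b c * f t b c * (cnj (N s' t a) * g a b c)))"
      by (subst sum.swap) (rule sum.cong[OF refl], rule sum.swap)
    also have "\<dots> = (\<Sum>b\<in>B. \<Sum>c\<in>B. \<Sum>a\<in>B. \<Sum>t\<in>B. \<sigma> * (W a b c * f a b c * (cnj (N s' a t) * g t b c)))"
      by (rule sum.cong[OF refl], rule sum.cong[OF refl], rule sum.swap)
    also have "\<dots> = (\<Sum>a\<in>B. \<Sum>b\<in>B. \<Sum>c\<in>B. \<Sum>t\<in>B. \<sigma> * (W a b c * f a b c * (cnj (N s' a t) * g t b c)))"
      by (rule sym, subst sum.swap) (rule sum.cong[OF refl], rule sum.swap)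
    finally show ?thesis .
  qed
  have 3: "(\<Sum>a\<in>B. \<Sum>b\<in>B. \<Sum>c\<in>B. \<Sum>t\<in>B. W a b c * (N s b t * f a t c) * g a b c)
     = (\<Sum>a\<in>B. \<Sum>b\<in>B. \<Sum>c\<in>B. \<Sum>t\<in>B. \<sigma> * (W a b c * f a b c * (cnj (N s' b t) * g a t c)))"
  proof (rule sum.cong[OF refl])
    fix a assume a: "a \<in> B"
    have "(\<Sum>b\<in>B. \<Sum>c\<in>B. \<Sum>t\<in>B. W a b c * (N s b t * f a t c) * g a b c)
      = (\<Sum>b\<in>B. \<Sum>c\<in>B. \<Sum>t\<in>B. \<sigma> * (W a t c * f a t c * (cnj (N s' t b) * g a b c)))"
    proof (intro sum.cong refl)
      fix b c t assume *: "b \<in> B" "c \<in> B" "t \<in> B"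
      have "W a b c * (N s b t * f a t c) * g a b c = (W a b c * N s b t) * f a t c * g a b c" by simp
      also have "\<dots> = \<sigma> * (W a t c * f a t c * (cnj (N s' t b) * g a b c))"
        by (subst dn2[OF a *]) simp
      finally show "W a b c * (N s b t * f a t c) * g a b c = \<sigma> * (W a t c * f a t c * (cnj (N s' t b) * g a b c))" .
    qed
    also have "\<dots> = (\<Sum>c\<in>B. \<Sum>b\<in>B. \<Sum>t\<in>B. \<sigma> * (W a t c * f a t c * (cnj (N s' t b) * g a b c)))"
      by (rule sum.swap)
    also have "\<dots> = (\<Sum>c\<in>B. \<Sum>b\<in>B. \<Sum>t\<in>B. \<sigma> * (W a b c * f a b c * (cnj (N s' b t) * g a t c)))"
      by (rule sum.cong[OF refl], rule sum.swap)
    also have "\<dots> = (\<Sum>b\<in>B. \<Sum>c\<in>B. \<Sum>t\<in>B. \<sigma> * (W a b c * f a b c * (cnj (N s' b t) * g a t c)))"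
      by (rule sum.swap)
    finally show "(\<Sum>b\<in>B. \<Sum>c\<in>B. \<Sum>t\<in>B. W a b c * (N s b t * f a t c) * g a b c) = \<dots>" .
  qed
  have "form w (Lie2 (unit s) F) G = (\<Sum>a\<in>B. \<Sum>b\<in>B. \<Sum>c\<in>B. W a b c *
      ((\<Sum>t\<in>B. f a b t * N s t c) - (\<Sum>t\<in>B. N s a t * f t b c) - (\<Sum>t\<in>B. N s b t * f a t c)) * g a b c)"
    unfolding form_nested by (intro sum.cong refl) (simp add: Lie2_coord F s f_def g_def W_def)
  also have "\<dots> = (\<Sum>a\<in>B. \<Sum>b\<in>B. \<Sum>c\<in>B. \<Sum>t\<in>B. W a b c * (f a b t * N s t c) * g a b c)
      - (\<Sum>a\<in>B. \<Sum>b\<in>B. \<Sum>c\<in>B. \<Sum>t\<in>B. W a b c * (N s a t * f t b c) * g a b c)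
      - (\<Sum>a\<in>B. \<Sum>b\<in>B. \<Sum>c\<in>B. \<Sum>t\<in>B. W a b c * (N s b t * f a t c) * g a b c)"
    by (simp only: left_diff_distrib right_diff_distrib sum_subtractf sum_distrib_left sum_distrib_right)
  also have "\<dots> = \<sigma> * (\<Sum>a\<in>B. \<Sum>b\<in>B. \<Sum>c\<in>B. W a b c * f a b c *
      ((\<Sum>t\<in>B. g a b t * cnj (N s' t c)) - (\<Sum>t\<in>B. cnj (N s' a t) * g t b c) - (\<Sum>t\<in>B. cnj (N s' b t) * g a t c)))"
    unfolding 1 2 3
    by (simp only: left_diff_distrib right_diff_distrib sum_subtractf sum_distrib_left sum_distrib_right)
  also have "\<dots> = \<sigma> * form w F (Lie2 (unit s') G)"
    unfolding form_nested
    by (intro arg_cong[of _ _ "(*) \<sigma>"] sum.cong refl) (simp add: Lie2_coord G s f_def g_def W_def)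
  finally show ?thesis .
qed

lemma endo_expand_elem:
  assumes "endo \<psi>"
  shows "\<psi> x = (\<Sum>i\<in>B \<times> B. scal (\<psi> (unit (fst i)) (snd i)) (elem (fst i) (unit (snd i)) x))"
proof -
  have "\<psi> x = (\<Sum>p\<in>B. scal (x p) (\<psi> (unit p)))" by (rule endo_expand[OF assms])
  also have "\<dots> = (\<Sum>p\<in>B. scal (x p) (\<Sum>q\<in>B. scal (\<psi> (unit p) q) (unit q)))"
    by (simp add: proj_expand[symmetric] proj_id endoD(4)[OF assms])
  also have "\<dots> = (\<Sum>p\<in>B. \<Sum>q\<in>B. scal (\<psi> (unit p) q) (elem p (unit q) x))"
    by (simp add: scal_sum_right elem_def mult.commute)
  also have "\<dots> = (\<Sum>i\<in>B \<times> B. scal (\<psi> (unit (fst i)) (snd i)) (elem (fst i) (unit (snd i)) x))"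
    by (simp add: sum.cartesian_product split_def)
  finally show ?thesis .
qed

text \<open>
  Let \<open>F'\<close> be the part of \<open>F\<close> orthogonal to all coboundaries. Its derivative along \<open>s\<close> is a coboundary
  \<open>cob \<psi>\<close> by Cartan's formula. The squared length of \<open>cob \<psi>\<close> equals, by adjointness, a multiple of the
  product of \<open>F'\<close> with the derivative of \<open>cob \<psi>\<close>, which is again a coboundary; so it is zero.
\<close>

lemma cohomologous_invariant:
  fixes w :: "'g \<Rightarrow> real"
  assumes c: "cocycle F" and w: "\<And>a. a \<in> B \<Longrightarrow> w a > 0" and S: "S \<subseteq> B"
    and adj: "\<And>s. s \<in> S \<Longrightarrow> \<exists>s'\<in>B. \<exists>\<sigma>. \<forall>a\<in>B. \<forall>c\<in>B.
      N s a c * of_real (w c) = \<sigma> * cnj (N s' c a) * of_real (w a)"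
  shows "\<exists>\<phi>. endo \<phi> \<and> (\<forall>s\<in>S. \<forall>x y. Lie2 (unit s) (\<lambda>x y. F x y - cob \<phi> x y) x y = 0)"
proof -
  let ?I = "B \<times> B \<times> B" and ?w = "\<lambda>(a, b, c). w c / (w a * w b)"
  define E where "E i = elem (fst i) (unit (snd i))" for i :: "'g \<times> 'g"
  have E: "endo (E i)" if "i \<in> B \<times> B" for i
    using that by (auto simp: E_def intro!: endo_elem)
  have wI: "t \<in> ?I \<Longrightarrow> ?w t > 0" for t using w by auto
  obtain l where l: "\<forall>j\<in>B \<times> B. herm ?I ?w
      (\<lambda>t. coords F t - (\<Sum>i\<in>B \<times> B. l i * coords (cob (E i)) t)) (coords (cob (E j))) = 0"
    using orthogonal_residual[of "B \<times> B" ?I ?w "coords F" "\<lambda>i. coords (cob (E i))"] wI by auto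
  define \<phi> where "\<phi> = (\<lambda>x. \<Sum>i\<in>B \<times> B. scal (l i) (E i x))"
  have \<phi>: "endo \<phi>" unfolding \<phi>_def by (intro endo_sumI endo_scal E)
  define F' where "F' = (\<lambda>x y. F x y - cob \<phi> x y)"
  have c': "cocycle F'" unfolding F'_def by (rule cocycle_diff[OF c cocycle_cob[OF \<phi>]])
  note F' = cocycle_alt2[OF c']
  have "coords F' = (\<lambda>t. coords F t - (\<Sum>i\<in>B \<times> B. l i * coords (cob (E i)) t))"
    by (auto simp: coords_def F'_def \<phi>_def cob_lincomb sum_fun_apply pointwise)
  then have orthE: "herm ?I ?w (coords F') (coords (cob (E j))) = 0" if "j \<in> B \<times> B" for j
    using l[rule_format, OF that] by simp
  have orth: "form w F' (cob \<psi>) = 0" if \<psi>: "endo \<psi>" for \<psi>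
  proof -
    have "\<psi> = (\<lambda>x. \<Sum>i\<in>B \<times> B. scal (\<psi> (unit (fst i)) (snd i)) (E i x))"
      unfolding E_def by (rule ext) (rule endo_expand_elem[OF \<psi>])
    then have "cob \<psi> x y = (\<Sum>i\<in>B \<times> B. scal (\<psi> (unit (fst i)) (snd i)) (cob (E i) x y))" for x y
      by (metis (no_types) cob_lincomb)
    then have "coords (cob \<psi>) = (\<lambda>t. \<Sum>i\<in>B \<times> B. \<psi> (unit (fst i)) (snd i) * coords (cob (E i)) t)"
      by (auto simp: coords_def sum_fun_apply pointwise)
    then show ?thesis
      using orthE by (simp add: form_def herm_sum_right)
  qed
  have "Lie2 (unit s) F' x y = 0" if s: "s \<in> S" for s x y
  proof -
    obtain s' \<sigma> where s': "s' \<in> B" and a: "\<And>a c. a \<in> B \<Longrightarrow> c \<in> B \<Longrightarrow>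
        N s a c * of_real (w c) = \<sigma> * cnj (N s' c a) * of_real (w a)"
      using adj[OF s] by blast
    have sB: "s \<in> B" using s S by blast
    define \<psi> where "\<psi> = F' (unit s)"
    have \<psi>: "endo \<psi>" unfolding \<psi>_def by (rule alt2_right[OF F'])
    have L: "Lie2 (unit s) F' = cob \<psi>"
      unfolding \<psi>_def by (intro ext) (simp add: Lie2_cocycle[OF c'])
    have L': "Lie2 (unit s') (cob \<psi>) = cob (Lie1 (unit s') \<psi>)"
      by (intro ext) (simp add: Lie2_cob[OF \<psi>])
    have "form w (Lie2 (unit s) F') (cob \<psi>) = \<sigma> * form w F' (cob (Lie1 (unit s') \<psi>))"
      using form_Lie2_adjoint[OF w sB s' a F' alt2_cob[OF \<psi>]] L' by simp
    also have "\<dots> = 0" by (simp add: orth endo_Lie1[OF \<psi>])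
    finally have "herm ?I ?w (coords (cob \<psi>)) (coords (cob \<psi>)) = 0"
      by (simp add: L form_def)
    then have "coords (cob \<psi>) t = 0" if "t \<in> ?I" for t
      using herm_self_zero[OF _ wI _ that] by simp
    then have z: "cob \<psi> (unit a) (unit b) c = 0" if "a \<in> B" "b \<in> B" "c \<in> B" for a b c
      using that by (force simp: coords_def)
    have "cob \<psi> (unit a) (unit b) = 0" if "a \<in> B" "b \<in> B" for a b
    proof
      fix c
      show "cob \<psi> (unit a) (unit b) c = 0 c"
        using z[OF that, of c] endoD(4)[OF endo_cob[OF \<psi>], of "unit a" "unit b"]
        by (cases "c \<in> B") (auto simp: carrier_def pointwise)
    qed
    then have "cob \<psi> x y = 0"
      by (rule alt2_eqI[OF alt2_cob[OF \<psi>] alt2_zero])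
    then show ?thesis by (simp add: L)
  qed
  with \<phi> show ?thesis unfolding F'_def by blast
qed

text \<open>
  Invariance under \<open>x\<close> makes \<open>F x\<close> a derivation (Cartan's formula again); comparing with invariance
  under \<open>y\<close> leaves this identity.
\<close>

lemma invariant_cocycle_bracket:
  assumes c: "cocycle F" and x: "\<And>y z. Lie2 x F y z = 0" and y: "\<And>x z. Lie2 y F x z = 0"
  shows "F (br x y) z = br (F x y) z"
proof -
  note F = cocycle_alt2[OF c]
  have "br y (F x z) - br z (F x y) - F x (br y z) = 0"
    using x[of y z] unfolding Lie2_cocycle[OF c] cob_def .
  moreover have "br y (F x z) - F (br y x) z - F x (br y z) = 0"
    using y[of x z] unfolding Lie2_def .
  ultimately have "F (br y x) z = br z (F x y)"
    by (metis diff_right_commute eq_iff_diff_eq_0)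
  then show ?thesis
    using br_anti[of x y] br_anti[of "F x y" z] alt2D(13)[OF F, of "br y x" z] by simp
qed

section \<open>From cochains on lists to bilinear maps\<close>

lemma tuples_1: "tuples carrier 1 = {[x] | x. x \<in> carrier}"
  by (auto simp: tuples_def length_Suc_conv)

lemma tuples_2: "tuples carrier 2 = {[x, y] | x y. x \<in> carrier \<and> y \<in> carrier}"
  by (auto simp: tuples_def length_Suc_conv numeral_2_eq_2)

lemma mem_tuples [simp]:
  "[x] \<in> tuples carrier (Suc 0) \<longleftrightarrow> x \<in> carrier"
  "[x, y] \<in> tuples carrier 2 \<longleftrightarrow> x \<in> carrier \<and> y \<in> carrier"
  by (auto simp: tuples_def)

definition cochain1 where
  "cochain1 \<phi> xs = (if xs \<in> tuples carrier 1 then \<phi> (xs ! 0) else 0)"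

definition cochain2 where
  "cochain2 F xs = (if xs \<in> tuples carrier 2 then F (xs ! 0) (xs ! 1) else 0)"

lemma CE_diff_1:
  assumes "x \<in> carrier" "y \<in> carrier"
  shows "CE_diff carrier br scal br 1 f [x, y] = br x (f [y]) - br y (f [x]) - f [br x y]"
proof -
  have "[x, y] \<in> tuples carrier (Suc 1)"
    using assms by (simp add: tuples_def)
  then show ?thesis
    by (simp add: CE_diff_def omit_nth_def atMost_Suc lessThan_Suc scal_minus_left)
qed

lemma CE_diff_2:
  assumes "x \<in> carrier" "y \<in> carrier" "z \<in> carrier"
  shows "CE_diff carrier br scal br 2 f [x, y, z] = br x (f [y, z]) - br y (f [x, z]) + br z (f [x, y])
     - f [br x y, z] + f [br x z, y] - f [br y z, x]"
proof -
  have "[x, y, z] \<in> tuples carrier (Suc 2)"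
    using assms by (simp add: tuples_def)
  then show ?thesis
    by (simp add: CE_diff_def omit_nth_def numeral_2_eq_2 atMost_Suc lessThan_Suc scal_minus_left)
qed

lemma cochain1_in: assumes e: "endo \<phi>" shows "cochain1 \<phi> \<in> CE_cochains scal carrier scal carrier 1"
proof -
  have val: "cochain1 \<phi> [x] = \<phi> x" if "x \<in> carrier" for x
    using that by (simp add: cochain1_def)
  have ball: "(\<forall>xs\<in>tuples carrier 1. P xs) \<longleftrightarrow> (\<forall>x\<in>carrier. P [x])" for P
    unfolding tuples_1 by blast
  show ?thesis
    unfolding CE_cochains_def mem_Collect_eq ball
  proof (intro conjI ballI allI impI)
    show "cochain1 \<phi> xs = 0" if "xs \<notin> tuples carrier 1" for xs
      using that by (simp add: cochain1_def)
    fix x i y c assume x: "x \<in> carrier" and i: "i < (1::nat)"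
    show "cochain1 \<phi> ([x][i := scal c ([x] ! i)]) = scal c (cochain1 \<phi> [x])"
      using x i by (simp add: val carrier_scal endoD(2)[OF e])
    assume "y \<in> carrier"
    then show "cochain1 \<phi> ([x][i := [x] ! i + y]) = cochain1 \<phi> [x] + cochain1 \<phi> ([x][i := y])"
      using x i by (simp add: val carrier_add endoD(1)[OF e])
  qed (simp_all add: val endoD(4)[OF e])
qed

lemma cochain1_onto:
  assumes f: "f \<in> CE_cochains scal carrier scal carrier 1"
  shows "\<exists>\<phi>. endo \<phi> \<and> f = cochain1 \<phi>"
proof (intro exI conjI)
  let ?\<phi> = "\<lambda>x. f [proj x]"
  have t: "[x] \<in> tuples carrier 1" if "x \<in> carrier" for x
    using that by simp
  have add: "f [x + y] = f [x] + f [y]" if "x \<in> carrier" "y \<in> carrier" for x y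
  proof -
    have "\<forall>xs\<in>tuples carrier 1. \<forall>i<1. \<forall>y\<in>carrier. f (xs[i := xs ! i + y]) = f xs + f (xs[i := y])"
      using f by (simp add: CE_cochains_def)
    from this[rule_format, of "[x]" 0 y] show ?thesis using t that by simp
  qed
  have sc: "f [scal c x] = scal c (f [x])" if "x \<in> carrier" for x c
  proof -
    have "\<forall>xs\<in>tuples carrier 1. \<forall>i<1. \<forall>c. f (xs[i := scal c (xs ! i)]) = scal c (f xs)"
      using f by (simp add: CE_cochains_def)
    from this[rule_format, of "[x]" 0 c] show ?thesis using t that by simp
  qed
  have car: "f [x] \<in> carrier" if "x \<in> carrier" for x
    using f t[OF that] by (simp add: CE_cochains_def)
  show "endo ?\<phi>"
    unfolding endo_def by (simp add: proj_add proj_scal add sc car proj_id)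
  show "f = cochain1 ?\<phi>"
  proof
    fix xs
    show "f xs = cochain1 ?\<phi> xs"
    proof (cases "xs \<in> tuples carrier 1")
      case True
      then show ?thesis by (auto simp: cochain1_def tuples_1[simplified] proj_id)
    next
      case False
      then have "f xs = 0" using f by (simp add: CE_cochains_def)
      then show ?thesis using False by (simp add: cochain1_def)
    qed
  qed
qed

lemma CE_diff_cochain1: "CE_diff carrier br scal br 1 (cochain1 \<phi>) = cochain2 (cob \<phi>)"
proof
  fix xs
  show "CE_diff carrier br scal br 1 (cochain1 \<phi>) xs = cochain2 (cob \<phi>) xs"
  proof (cases "xs \<in> tuples carrier 2")
    case True
    then obtain x y where xs: "xs = [x, y]" and c: "x \<in> carrier" "y \<in> carrier"
      by (auto simp: tuples_2)
    have "[x] \<in> tuples carrier 1" "[y] \<in> tuples carrier 1" "[br x y] \<in> tuples carrier 1"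
      using c by simp_all
    then show ?thesis
      using True unfolding xs CE_diff_1[OF c] by (simp add: cochain1_def cochain2_def cob_def)
  next
    case False
    then show ?thesis by (simp add: CE_diff_def cochain2_def numeral_2_eq_2)
  qed
qed

lemma coboundaries_2:
  "CE_coboundaries scal carrier br scal carrier br 2 = {cochain2 (cob \<phi>) | \<phi>. endo \<phi>}"
proof -
  have "CE_coboundaries scal carrier br scal carrier br 2 =
      CE_diff carrier br scal br 1 ` CE_cochains scal carrier scal carrier 1"
    by (simp add: CE_coboundaries_def numeral_2_eq_2)
  also have "CE_cochains scal carrier scal carrier 1 = {cochain1 \<phi> | \<phi>. endo \<phi>}"
    using cochain1_in cochain1_onto by blast
  finally show ?thesis
    by (simp only: setcompr_eq_image image_image CE_diff_cochain1)
qed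

lemma cocycle_of_CE_cocycle:
  assumes f: "f \<in> CE_cocycles scal carrier br scal carrier br 2"
  shows "\<exists>F. cocycle F \<and> f = cochain2 F"
proof (intro exI conjI)
  let ?F = "\<lambda>x y. f [proj x, proj y]"
  have fc: "f \<in> CE_cochains scal carrier scal carrier 2" and d: "CE_diff carrier br scal br 2 f = (\<lambda>_. 0)"
    using f by (auto simp: CE_cocycles_def)
  have t: "[x, y] \<in> tuples carrier 2" if "x \<in> carrier" "y \<in> carrier" for x y
    using that by (simp add: tuples_2)
  have A: "\<forall>xs\<in>tuples carrier 2. \<forall>i<2. \<forall>y\<in>carrier. f (xs[i := xs ! i + y]) = f xs + f (xs[i := y])"
    and S: "\<forall>xs\<in>tuples carrier 2. \<forall>i<2. \<forall>c. f (xs[i := scal c (xs ! i)]) = scal c (f xs)"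
    and Z: "\<forall>xs\<in>tuples carrier 2. \<forall>j<2. \<forall>i<j. xs ! i = xs ! j \<longrightarrow> f xs = 0"
    using fc by (simp_all add: CE_cochains_def)
  have add1: "f [x + x', y] = f [x, y] + f [x', y]" and add2: "f [y, x + x'] = f [y, x] + f [y, x']"
    if "x \<in> carrier" "y \<in> carrier" "x' \<in> carrier" for x x' y
    using A[rule_format, of "[x, y]" 0 x'] A[rule_format, of "[y, x]" 1 x'] t that by simp_all
  have sc: "f [y, scal c x] = scal c (f [y, x])" if "x \<in> carrier" "y \<in> carrier" for x y c
    using S[rule_format, of "[y, x]" 1 c] t that by simp
  have car: "f [x, y] \<in> carrier" if "x \<in> carrier" "y \<in> carrier" for x y
    using fc t[OF that] by (simp add: CE_cochains_def)
  have alt: "f [x, x] = 0" if "x \<in> carrier" for x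
    using Z[rule_format, of "[x, x]" 1 0] t[OF that that] by simp
  have anti: "f [x, y] = - f [y, x]" if xy: "x \<in> carrier" "y \<in> carrier" for x y
  proof -
    have "f [x + y, x + y] = f [x, x] + f [x, y] + (f [y, x] + f [y, y])"
      using xy by (simp add: add1 add2 carrier_add)
    then have "f [x, y] + f [y, x] = 0"
      using xy by (simp add: alt carrier_add)
    then show ?thesis by (simp add: eq_neg_iff_add_eq_0)
  qed
  have "endo (?F x)" for x
    unfolding endo_def
    by (intro conjI allI) (simp_all add: proj_add proj_scal add2 sc car proj_id)
  moreover have "?F x y = - ?F y x" for x y
    by (rule anti) simp_all
  ultimately have "alt2 ?F" unfolding alt2_def by blast
  moreover have "br x (?F y z) - br y (?F x z) + br z (?F x y) - ?F (br x y) z + ?F (br x z) y - ?F (br y z) x = 0"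
    for x y z
  proof -
    have p: "br (proj x) v = br x v" for x v by (rule brD(10))
    have q: "br v (proj x) = br v x" for x v by (rule brD(3))
    have "CE_diff carrier br scal br 2 f [proj x, proj y, proj z] = 0"
      by (simp add: d)
    then show ?thesis
      by (simp add: CE_diff_2 p q proj_id)
  qed
  ultimately show "cocycle ?F" by (simp add: cocycle_def)
  show "f = cochain2 ?F"
  proof
    fix xs
    show "f xs = cochain2 ?F xs"
    proof (cases "xs \<in> tuples carrier 2")
      case True
      then show ?thesis by (auto simp: cochain2_def tuples_2 proj_id)
    next
      case False
      then have "f xs = 0" using fc by (simp add: CE_cochains_def)
      then show ?thesis using False by (simp add: cochain2_def)
    qed
  qed
qed

lemma zero_CE_cocycle: "(\<lambda>_. 0) \<in> CE_cocycles scal carrier br scal carrier br 2"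
proof -
  have "CE_diff carrier br scal br 2 (\<lambda>_. 0) xs = 0" for xs
    by (simp add: CE_diff_def brD)
  then have "CE_diff carrier br scal br 2 (\<lambda>_. 0) = (\<lambda>_. 0)"
    by (rule ext)
  then show ?thesis
    by (simp add: CE_cocycles_def CE_cochains_def)
qed

text \<open>
  The classes are the cosets of cocycles, so the quotient consists of the coset of zero alone as
  soon as every cocycle is a coboundary.
\<close>

theorem cohomology_2_trivial:
  assumes exact: "\<And>F. cocycle F \<Longrightarrow> \<exists>\<phi>. endo \<phi> \<and> (\<forall>x y. F x y = cob \<phi> x y)"
  shows "adjoint_cohomology scal carrier br 2 = {adjoint_coboundaries scal carrier br 2}"
proof -
  let ?Z = "CE_cocycles scal carrier br scal carrier br 2"
  let ?B = "CE_coboundaries scal carrier br scal carrier br 2"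
  have diffB: "(\<lambda>xs. g xs - h xs) \<in> ?B" if gh: "g \<in> ?B" "h \<in> ?B" for g h
  proof -
    obtain \<phi> \<psi> where "endo \<phi>" "endo \<psi>" "g = cochain2 (cob \<phi>)" "h = cochain2 (cob \<psi>)"
      using gh unfolding coboundaries_2 by blast
    then have "(\<lambda>xs. g xs - h xs) = cochain2 (cob (\<lambda>x. \<phi> x - \<psi> x))" "endo (\<lambda>x. \<phi> x - \<psi> x)"
      by (auto simp: cochain2_def cob_diff endo_diff)
    then show ?thesis unfolding coboundaries_2 by blast
  qed
  have ZB: "?Z \<subseteq> ?B"
  proof
    fix f assume "f \<in> ?Z"
    then obtain F where F: "cocycle F" "f = cochain2 F"
      using cocycle_of_CE_cocycle by blast
    then obtain \<phi> where "endo \<phi>" "\<forall>x y. F x y = cob \<phi> x y"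
      using exact by blast
    moreover from this have "F = cob \<phi>" by (intro ext) simp
    ultimately show "f \<in> ?B" using F unfolding coboundaries_2 by blast
  qed
  have zB: "(\<lambda>_. 0) \<in> ?B" using zero_CE_cocycle ZB by blast
  have coset: "{\<lambda>xs. f xs + g xs | g. g \<in> ?B} = ?B" if f: "f \<in> ?B" for f
  proof
    show "{\<lambda>xs. f xs + g xs | g. g \<in> ?B} \<subseteq> ?B"
    proof clarify
      fix g assume "g \<in> ?B"
      from diffB[OF f diffB[OF zB this]] show "(\<lambda>xs. f xs + g xs) \<in> ?B" by simp
    qed
    show "?B \<subseteq> {\<lambda>xs. f xs + g xs | g. g \<in> ?B}"
    proof
      fix h assume "h \<in> ?B"
      from diffB[OF this f] show "h \<in> {\<lambda>xs. f xs + g xs | g. g \<in> ?B}"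
        by (intro CollectI exI[of _ "\<lambda>xs. h xs - f xs"]) auto
    qed
  qed
  have "adjoint_cohomology scal carrier br 2 = (\<lambda>_. ?B) ` ?Z"
    unfolding CE_cohomology_def by (rule image_cong[OF refl], rule coset) (use ZB in blast)
  also have "\<dots> = {?B}" by (rule image_constant[OF zero_CE_cocycle])
  finally show ?thesis .
qed

end

section \<open>Brackets and the Jacobi identity of the mass central extension\<close>

lemma cga_scale_eq: "cga_scale = scal"
  by (simp add: cga_scale_def scal_def fun_eq_iff)

lemma gen_vec_eq: "gen_vec = unit"
  by (simp add: gen_vec_def unit_def fun_eq_iff)

lemma cga_bracket_eq: "cga_bracket d k = bil (cga_basis d k) (gen_bracket k)"
  by (simp add: cga_bracket_def bil_def cga_scale_eq fun_eq_iff)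

lemma kdelta_simps [simp]: "kdelta i i = 1" "i \<noteq> j \<Longrightarrow> kdelta i j = 0"
  by (simp_all add: kdelta_def)

lemma kdelta_commute: "kdelta i j = kdelta j i"
  by (simp add: kdelta_def)

lemma finite_cga_basis: "finite (cga_basis d k)"
proof -
  have "cga_basis d k \<subseteq> {CC, DD, HH, Mass} \<union> case_prod Rot ` ({1..d} \<times> {1..d}) \<union>
      case_prod PP ` ({..two_ell k} \<times> {1..d})"
    by (auto simp: cga_basis_def)
  then show ?thesis by (rule finite_subset) auto
qed

lemma rot_eq: "rot i j = (if i < j then unit (Rot i j) else 0) - (if j < i then unit (Rot j i) else 0)"
  by (simp add: rot_def gen_vec_eq)

lemma rot_anti: "rot i j = - rot j i"
  by (simp add: rot_def)

lemma rot_self [simp]: "rot i i = 0"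
  by (simp add: rot_def)

lemma rot_less: "i < j \<Longrightarrow> rot i j = unit (Rot i j)"
  by (simp add: rot_def gen_vec_eq)

text \<open>
  Invariance under \<open>H\<close> of the pairing of the \<open>P\<^sub>m\<close> with coefficients \<open>b\<^sub>m\<close>; below are its invariance
  under \<open>C\<close> and its antisymmetry.
\<close>

lemma mass_coeff_lower:
  assumes "m + n = Suc (two_ell k)" "n \<le> two_ell k" "m \<le> two_ell k"
  shows "of_nat m * mass_coeff k (m - 1) + of_nat n * mass_coeff k m = 0"
proof -
  obtain m' where m: "m = Suc m'" using assms by (cases m) auto
  obtain n' where n: "n = Suc n'" using assms by (cases n) auto
  have "two_ell k - m' = Suc n'" "two_ell k - Suc m' = n'" using assms m n by simp_all
  then show ?thesis unfolding m n by (simp add: mass_coeff_def algebra_simps)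
qed

lemma mass_coeff_raise:
  assumes "Suc (m + n) = two_ell k"
  shows "(of_nat (two_ell k) - of_nat m) * mass_coeff k (Suc m)
     + (of_nat (two_ell k) - of_nat n) * mass_coeff k m = 0"
proof -
  have "two_ell k - m = Suc n" "two_ell k - Suc m = n" "of_nat (two_ell k) - of_nat m = (of_nat (Suc n) :: complex)"
    "of_nat (two_ell k) - of_nat n = (of_nat (Suc m) :: complex)"
    unfolding assms[symmetric] by simp_all
  then show ?thesis by (simp only:) (simp add: mass_coeff_def algebra_simps)
qed

lemma mass_coeff_flip:
  assumes "m + n = two_ell k" shows "mass_coeff k n = - mass_coeff k m"
proof -
  have "two_ell k - m = n" "two_ell k - n = m" using assms by simp_all
  moreover have "(-1 :: complex) ^ (n + k + 1) = - ((-1) ^ (m + k + 1))"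
  proof -
    have "odd (m + n)" using assms by simp
    then show ?thesis by (cases "even m") (auto simp: power_add)
  qed
  ultimately show ?thesis unfolding mass_coeff_def by simp
qed

lemma two_ell_eq: "2 * ell k = of_nat (two_ell k)"
  by (simp add: ell_def)

locale cga =
  fixes d k :: nat
begin

abbreviation "BB \<equiv> cga_basis d k"

end

sublocale cga \<subseteq> based_space "cga_basis d k"
  by standard (rule finite_cga_basis)

context cga
begin

definition idx :: "nat \<Rightarrow> bool" where "idx i \<longleftrightarrow> 1 \<le> i \<and> i \<le> d"

lemma mem_cga_basis [simp]:
  "CC \<in> BB" "DD \<in> BB" "HH \<in> BB" "Mass \<in> BB"
  "Rot i j \<in> BB \<longleftrightarrow> idx i \<and> idx j \<and> i < j"
  "PP n i \<in> BB \<longleftrightarrow> n \<le> two_ell k \<and> idx i"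
  by (auto simp: cga_basis_def idx_def)

lemma rot_carrier: "idx i \<Longrightarrow> idx j \<Longrightarrow> rot i j \<in> carrier"
  by (auto simp: rot_eq intro: carrier_minus)

lemma BB_cases:
  assumes "a \<in> BB"
  obtains "a = CC" | "a = DD" | "a = HH" | "a = Mass"
    | i j where "a = Rot i j" "idx i" "idx j" "i < j"
    | n i where "a = PP n i" "n \<le> two_ell k" "idx i"
  using assms by (cases a) (auto)

lemma gen_bracket_carrier:
  assumes "a \<in> BB" "b \<in> BB" shows "gen_bracket k a b \<in> carrier"
  using assms(1)
proof (cases rule: BB_cases)
  case 5
  from assms(2) this show ?thesis
    by (cases rule: BB_cases)
      (auto simp: cga_scale_eq gen_vec_eq intro!: carrier_minus carrier_diff carrier_add carrier_scal rot_carrier carrier_unit)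
next
  case (6 n i)
  have "scal (2 * ell k - of_nat n) (unit (PP (Suc n) i)) \<in> carrier"
    using 6 by (cases "n = two_ell k") (auto simp: two_ell_eq intro!: carrier_scal carrier_unit )
  from assms(2) 6 this show ?thesis
    by (cases rule: BB_cases)
      (auto simp: cga_scale_eq gen_vec_eq intro!: carrier_minus carrier_diff carrier_add carrier_scal rot_carrier carrier_unit )
next
  case 1
  have "scal (2 * ell k - of_nat n) (unit (PP (Suc n) i)) \<in> carrier" if "n \<le> two_ell k" "idx i" for n i
    using that by (cases "n = two_ell k") (auto simp: two_ell_eq intro!: carrier_scal carrier_unit )
  from assms(2) 1 this show ?thesis
    by (cases rule: BB_cases)
      (auto simp: cga_scale_eq gen_vec_eq intro!: carrier_minus carrier_scal carrier_unit)
qed (use assms(2) in \<open>cases rule: BB_cases,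
      auto simp: cga_scale_eq gen_vec_eq intro!: carrier_minus carrier_scal carrier_unit\<close>)+

lemma gen_bracket_anti: "gen_bracket k a b = - gen_bracket k b a"
proof (cases a)
  case (Rot i j)
  then show ?thesis
  proof (cases b)
    case b: (Rot p r)
    show ?thesis unfolding Rot b cga_scale_eq gen_bracket.simps
      using rot_anti[of i p] rot_anti[of i r] rot_anti[of j p] rot_anti[of j r]
      by (simp add: kdelta_commute[of _ i] kdelta_commute[of _ j] scal_minus_right)
  qed simp_all
next
  case (PP m i)
  then show ?thesis
  proof (cases b)
    case b: (PP n j)
    have "kdelta (m + n) (two_ell k) * mass_coeff k m = - (kdelta (m + n) (two_ell k) * mass_coeff k n)"
      using mass_coeff_flip[of m n k] by (cases "m + n = two_ell k") auto
    then show ?thesis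
      by (simp only: PP b gen_bracket.simps cga_scale_eq kdelta_commute[of j i] add.commute[of n m] mult.assoc)
        (simp add: scal_minus_left)
  qed simp_all
qed (cases b, simp_all)+

end

sublocale cga \<subseteq> based_algebra "cga_basis d k" "gen_bracket k"
  by standard (rule gen_bracket_carrier gen_bracket_anti; assumption?)+

context cga
begin

lemma br_sl2 [simp]:
  "br (unit DD) (unit HH) = scal 2 (unit HH)" "br (unit HH) (unit DD) = - scal 2 (unit HH)"
  "br (unit CC) (unit HH) = unit DD" "br (unit HH) (unit CC) = - unit DD"
  "br (unit DD) (unit CC) = - scal 2 (unit CC)" "br (unit CC) (unit DD) = scal 2 (unit CC)"
  "br (unit CC) (unit CC) = 0" "br (unit DD) (unit DD) = 0" "br (unit HH) (unit HH) = 0"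
  by (simp_all add: cga_scale_eq gen_vec_eq)

lemma br_Mass [simp]: "br (unit Mass) v = 0" "br v (unit Mass) = 0"
proof -
  show "br v (unit Mass) = 0"
  proof (rule endo_eqI[OF alt2_left[OF alt2_br] endo_zero])
    fix a assume "a \<in> BB"
    then show "br (unit a) (unit Mass) = 0" by (cases a) simp_all
  qed
  then show "br (unit Mass) v = 0" using br_anti[of "unit Mass" v] by simp
qed

lemma br_rot_sl2 [simp]:
  assumes "idx i" "idx j"
  shows "br (rot i j) (unit CC) = 0" "br (rot i j) (unit DD) = 0" "br (rot i j) (unit HH) = 0"
    "br (unit CC) (rot i j) = 0" "br (unit DD) (rot i j) = 0" "br (unit HH) (rot i j) = 0"
  using assms by (simp_all add: rot_eq brD)

text \<open>
  With vectors \<open>rot i j\<close> in place of basis elements the defining formula holds for all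
  index pairs, in either order, which is what makes the Jacobi identity for rotations provable
  without distinguishing orderings of the indices.
\<close>

lemma br_rot_rot:
  assumes "idx i" "idx j" "idx p" "idx r"
  shows "br (rot i j) (rot p r) = - scal (kdelta i p) (rot j r) - scal (kdelta j r) (rot i p)
     + scal (kdelta i r) (rot j p) + scal (kdelta j p) (rot i r)"
proof -
  have less: "br (rot i j) (rot p r) = - scal (kdelta i p) (rot j r) - scal (kdelta j r) (rot i p)
     + scal (kdelta i r) (rot j p) + scal (kdelta j p) (rot i r)"
    if "idx i" "idx j" "idx p" "idx r" "i < j" "p < r" for i j p r
    using that by (simp add: rot_less[of i j] rot_less[of p r] cga_scale_eq)
  have less2: "br (rot i j) (rot p r) = - scal (kdelta i p) (rot j r) - scal (kdelta j r) (rot i p)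
     + scal (kdelta i r) (rot j p) + scal (kdelta j p) (rot i r)"
    if *: "idx i" "idx j" "idx p" "idx r" "i < j" for i j p r
  proof (cases p r rule: linorder_cases)
    case greater
    show ?thesis
      using less[OF *(1,2,4,3,5) greater] rot_anti[of p r] by (simp add: brD(6) algebra_simps)
  next
    case equal
    then show ?thesis by (simp add: brD(5))
  qed (rule less[OF *])
  show ?thesis
  proof (cases i j rule: linorder_cases)
    case greater
    show ?thesis
      using less2[OF assms(2,1,3,4) greater] rot_anti[of i j] by (simp add: brD(13) algebra_simps)
  next
    case equal
    then show ?thesis by (simp add: brD(12))
  qed (rule less2[OF assms])
qed

lemma br_rot_PP:
  assumes "idx i" "idx j" "idx p" "n \<le> two_ell k"
  shows "br (rot i j) (unit (PP n p)) =
    scal (kdelta j p) (unit (PP n i)) - scal (kdelta i p) (unit (PP n j))"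
  using assms
  by (cases i j rule: linorder_cases)
    (auto simp: rot_def gen_vec_eq cga_scale_eq brD(12,13))

lemma br_HH_PP: "n \<le> two_ell k \<Longrightarrow> idx i \<Longrightarrow> br (unit HH) (unit (PP n i)) = - scal (of_nat n) (unit (PP (n - 1) i))"
  and br_DD_PP: "n \<le> two_ell k \<Longrightarrow> idx i \<Longrightarrow>
    br (unit DD) (unit (PP n i)) = scal (of_nat (two_ell k) - 2 * of_nat n) (unit (PP n i))"
  and br_CC_PP: "n \<le> two_ell k \<Longrightarrow> idx i \<Longrightarrow>
    br (unit CC) (unit (PP n i)) = scal (of_nat (two_ell k) - of_nat n) (unit (PP (Suc n) i))"
  and br_PP_PP: "m \<le> two_ell k \<Longrightarrow> n \<le> two_ell k \<Longrightarrow> idx i \<Longrightarrow> idx j \<Longrightarrow> br (unit (PP m i)) (unit (PP n j)) =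
     scal (kdelta i j * kdelta (m + n) (two_ell k) * mass_coeff k m) (unit Mass)"
  by (simp_all add: cga_scale_eq gen_vec_eq ell_def algebra_simps)

declare br_unit [simp del]

lemma br_PP_sl2:
  "br (unit (PP n i)) (unit CC) = - br (unit CC) (unit (PP n i))"
  "br (unit (PP n i)) (unit DD) = - br (unit DD) (unit (PP n i))"
  "br (unit (PP n i)) (unit HH) = - br (unit HH) (unit (PP n i))"
  "br (unit (PP n i)) (rot p r) = - br (rot p r) (unit (PP n i))"
  by (rule br_anti)+

definition Jac where "Jac x y z = br x (br y z) + br y (br z x) + br z (br x y)"

lemma Jac_cyc: "Jac x y z = 0 \<Longrightarrow> Jac y z x = 0"
  by (simp add: Jac_def ac_simps)

lemma Jac_swap: "Jac x y z = 0 \<Longrightarrow> Jac y x z = 0"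
proof -
  have "Jac y x z = - Jac x y z"
    unfolding Jac_def using brD(6)[of y "br x z"] brD(6)[of x "br y z"] brD(6)[of z "br x y"]
    by (simp add: br_anti[of z x] br_anti[of z y] br_anti[of y x] brD(6)) 
  then show "Jac x y z = 0 \<Longrightarrow> Jac y x z = 0" by simp
qed

lemmas br_lin = brD(1,2,5,6,7,8,9,12,13,14)

lemma Jac_sl2_sl2_PP:
  assumes "n \<le> two_ell k" "idx i"
  shows "Jac (unit CC) (unit DD) (unit (PP n i)) = 0" "Jac (unit CC) (unit HH) (unit (PP n i)) = 0"
    "Jac (unit DD) (unit HH) (unit (PP n i)) = 0"
proof -
  note s = Jac_def br_PP_sl2 br_HH_PP br_DD_PP br_CC_PP br_lin
  show "Jac (unit DD) (unit HH) (unit (PP n i)) = 0"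
    using assms by (cases n) (simp_all add: s, auto simp: fun_eq_iff pointwise algebra_simps)
  show "Jac (unit CC) (unit DD) (unit (PP n i)) = 0"
    using assms by (cases "n = two_ell k") (simp_all add: s, auto simp: fun_eq_iff pointwise algebra_simps)
  show "Jac (unit CC) (unit HH) (unit (PP n i)) = 0"
    using assms by (cases n; cases "n = two_ell k") (simp_all add: s, auto simp: fun_eq_iff pointwise algebra_simps)
qed

lemma Jac_sl2_rot_PP:
  assumes "n \<le> two_ell k" "idx i" "idx p" "idx q" "x \<in> {unit CC, unit DD, unit HH}"
  shows "Jac x (rot p q) (unit (PP n i)) = 0"
proof -
  note s = Jac_def br_PP_sl2 br_HH_PP br_DD_PP br_CC_PP br_rot_PP br_lin
  consider "x = unit CC" | "x = unit DD" | "x = unit HH" using assms(5) by blast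
  then show ?thesis using assms
    by cases (cases "n = two_ell k"; simp add: s; simp add: fun_eq_iff pointwise algebra_simps)+
qed

lemma Jac_sl2_PP_PP:
  assumes "m \<le> two_ell k" "n \<le> two_ell k" "idx i" "idx j" "x \<in> {unit CC, unit DD, unit HH}"
  shows "Jac x (unit (PP m i)) (unit (PP n j)) = 0"
proof -
  note s = Jac_def br_PP_sl2 br_HH_PP br_DD_PP br_CC_PP br_PP_PP br_lin
  consider "x = unit CC" | "x = unit DD" | "x = unit HH" using assms(5) by blast
  then show ?thesis
  proof cases
    case 1
    have a: "scal (of_nat (two_ell k) - of_nat m) (br (unit (PP n j)) (unit (PP (Suc m) i))) =
      - scal ((of_nat (two_ell k) - of_nat m) * kdelta i j * kdelta (Suc (m + n)) (two_ell k) * mass_coeff k (Suc m)) (unit Mass)"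
      using assms br_anti[of "unit (PP n j)" "unit (PP (Suc m) i)"]
      by (cases "m = two_ell k") (auto simp: br_PP_PP scal_minus_right mult.assoc)
    have b: "scal (of_nat (two_ell k) - of_nat n) (br (unit (PP m i)) (unit (PP (Suc n) j))) =
      scal ((of_nat (two_ell k) - of_nat n) * kdelta i j * kdelta (Suc (m + n)) (two_ell k) * mass_coeff k m) (unit Mass)"
      using assms by (cases "n = two_ell k") (auto simp: br_PP_PP mult.assoc)
    have c: "(of_nat (two_ell k) - of_nat m) * kdelta i j * kdelta (Suc (m + n)) (two_ell k) * mass_coeff k (Suc m)
       + (of_nat (two_ell k) - of_nat n) * kdelta i j * kdelta (Suc (m + n)) (two_ell k) * mass_coeff k m = 0"
      using mass_coeff_raise[of m n k]
      by (cases "Suc (m + n) = two_ell k"; cases "i = j") (simp_all del: of_nat_Suc)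
    have "Jac x (unit (PP m i)) (unit (PP n j)) =
        scal (of_nat (two_ell k) - of_nat m) (br (unit (PP n j)) (unit (PP (Suc m) i)))
        - scal (of_nat (two_ell k) - of_nat n) (br (unit (PP m i)) (unit (PP (Suc n) j)))"
      using assms by (simp add: 1 Jac_def br_PP_sl2 br_CC_PP br_PP_PP br_lin del: of_nat_Suc)
    also have "\<dots> = - scal ((of_nat (two_ell k) - of_nat m) * kdelta i j * kdelta (Suc (m + n)) (two_ell k) * mass_coeff k (Suc m)
       + (of_nat (two_ell k) - of_nat n) * kdelta i j * kdelta (Suc (m + n)) (two_ell k) * mass_coeff k m) (unit Mass)"
      unfolding a b scal_add_left by simp
    also have "\<dots> = 0" unfolding c by simp
    finally show ?thesis .
  next
    case 2
    have a: "(of_nat (two_ell k) - 2 * of_nat m) * mass_coeff k n = (of_nat (two_ell k) - 2 * of_nat n) * mass_coeff k m"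
      if "m + n = two_ell k"
      using mass_coeff_flip[OF that] unfolding that[symmetric] by (simp add: algebra_simps)
    have "Jac x (unit (PP m i)) (unit (PP n j)) = scal (kdelta i j * kdelta (m + n) (two_ell k) *
       ((of_nat (two_ell k) - 2 * of_nat m) * mass_coeff k n - (of_nat (two_ell k) - 2 * of_nat n) * mass_coeff k m)) (unit Mass)"
      using assms by (simp add: 2 s kdelta_commute[of j i] add.commute[of n m])
        (simp add: fun_eq_iff pointwise algebra_simps)
    then show ?thesis using a by (cases "m + n = two_ell k") simp_all
  next
    case 3
    have a: "scal (of_nat m) (br (unit (PP n j)) (unit (PP (m - 1) i))) =
      - scal (kdelta i j * (of_nat m * kdelta (m + n) (Suc (two_ell k)) * mass_coeff k (m - 1))) (unit Mass)"
      using assms br_anti[of "unit (PP n j)" "unit (PP (m - 1) i)"]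
      by (cases m) (auto simp: br_PP_PP scal_minus_right kdelta_def)
    have b: "scal (of_nat n) (br (unit (PP m i)) (unit (PP (n - 1) j))) =
      scal (kdelta i j * (of_nat n * kdelta (m + n) (Suc (two_ell k)) * mass_coeff k m)) (unit Mass)"
      using assms by (cases n) (auto simp: br_PP_PP kdelta_def)
    have c: "kdelta i j * (of_nat m * kdelta (m + n) (Suc (two_ell k)) * mass_coeff k (m - 1))
       + kdelta i j * (of_nat n * kdelta (m + n) (Suc (two_ell k)) * mass_coeff k m) = 0"
      using mass_coeff_lower[of m n k] assms
      by (cases "m + n = Suc (two_ell k)"; cases "i = j") simp_all
    have "Jac x (unit (PP m i)) (unit (PP n j)) =
        scal (of_nat n) (br (unit (PP m i)) (unit (PP (n - 1) j)))
        - scal (of_nat m) (br (unit (PP n j)) (unit (PP (m - 1) i)))"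
      using assms by (simp add: 3 Jac_def br_PP_sl2 br_HH_PP br_PP_PP br_lin)
    also have "\<dots> = scal (kdelta i j * (of_nat m * kdelta (m + n) (Suc (two_ell k)) * mass_coeff k (m - 1))
       + kdelta i j * (of_nat n * kdelta (m + n) (Suc (two_ell k)) * mass_coeff k m)) (unit Mass)"
      unfolding a b scal_add_left by simp
    also have "\<dots> = 0" unfolding c by simp
    finally show ?thesis .
  qed
qed

text \<open>
  Writing rotations as differences turns \<open>rot i j = - rot j i\<close>, which would loop as a rewrite rule,
  into an identity of free terms.
\<close>

lemma rot_decompose: obtains e where "\<And>i j. rot i j = e i j - e j i"
proof
  show "rot i j = (\<lambda>i j. if i < j then unit (Rot i j) else 0) i j - (\<lambda>i j. if i < j then unit (Rot i j) else 0) j i" for i j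
    by (simp add: rot_eq)
qed

lemma Jac_rot_rot_rot:
  assumes "idx i" "idx j" "idx p" "idx q" "idx r" "idx s"
  shows "Jac (rot i j) (rot p q) (rot r s) = 0"
proof -
  obtain e where e: "\<And>i j. rot i j = e i j - e j i" using rot_decompose by blast
  have "Jac (rot i j) (rot p q) (rot r s) g = 0" for g
    unfolding Jac_def
    by (simp add: br_rot_rot br_lin assms)
      (simp add: e pointwise algebra_simps kdelta_commute)
  then show ?thesis by (simp add: fun_eq_iff pointwise)
qed

lemma Jac_rot_rot_PP:
  assumes "idx i" "idx j" "idx p" "idx q" "idx r" "n \<le> two_ell k"
  shows "Jac (rot i j) (rot p q) (unit (PP n r)) = 0"
proof -
  have "Jac (rot i j) (rot p q) (unit (PP n r)) g = 0" for g
    unfolding Jac_def using assms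
    by (simp add: br_rot_rot br_PP_sl2 br_rot_PP br_lin)
      (simp add: pointwise algebra_simps kdelta_commute)
  then show ?thesis by (simp add: fun_eq_iff pointwise)
qed

lemma Jac_rot_PP_PP:
  assumes "idx i" "idx j" "idx p" "idx q" "m \<le> two_ell k" "n \<le> two_ell k"
  shows "Jac (rot i j) (unit (PP m p)) (unit (PP n q)) = 0"
proof (cases "m + n = two_ell k")
  case True
  then have "n + m = two_ell k" by simp
  have "Jac (rot i j) (unit (PP m p)) (unit (PP n q)) g = 0" for g
    unfolding Jac_def using assms
    by (simp add: br_PP_sl2 br_rot_PP br_PP_PP br_lin True \<open>n + m = two_ell k\<close> mass_coeff_flip[OF True])
      (simp add: pointwise algebra_simps kdelta_commute)
  then show ?thesis by (simp add: fun_eq_iff pointwise)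
next
  case False
  then have "n + m \<noteq> two_ell k" by simp
  with False assms show ?thesis
    by (simp add: Jac_def br_PP_sl2 br_rot_PP br_PP_PP br_lin)
qed

text \<open>
  The Jacobi identity for three generators is invariant under permuting them, so they may be
  sorted by their kind: \<open>sl\<^sub>2\<close>, rotation, \<open>P\<close>, mass.
\<close>

lemma Jac_basis:
  assumes "a \<in> BB" "b \<in> BB" "c \<in> BB"
  shows "Jac (unit a) (unit b) (unit c) = 0"
proof -
  define S where "S = {unit CC, unit DD, unit HH}"
  define R where "R = {rot i j | i j. idx i \<and> idx j}"
  define P where "P = {unit (PP n i) | n i. n \<le> two_ell k \<and> idx i}"
  define M where "M = {unit Mass}"
  have dup: "Jac x x z = 0" for x z
    using brD(6)[of x "br x z"] by (simp add: Jac_def br_anti[of z x] brD alt2_self[OF alt2_br])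
  have SSS: "Jac x y z = 0" if "x \<in> S" "y \<in> S" "z \<in> S" for x y z
    using that by (auto simp: S_def Jac_def br_lin scal_minus_right)
  have SSR: "Jac x y z = 0" if "x \<in> S" "y \<in> S" "z \<in> R" for x y z
    using that by (auto simp: S_def R_def Jac_def br_lin)
  have SRR: "Jac x y z = 0" if "x \<in> S" "y \<in> R" "z \<in> R" for x y z
    using that by (auto simp: S_def R_def Jac_def br_rot_rot br_lin)
  have SSP: "Jac x y z = 0" if "x \<in> S" "y \<in> S" "z \<in> P" for x y z
    using that Jac_sl2_sl2_PP Jac_swap dup unfolding S_def P_def by blast
  have SRP: "Jac x y z = 0" if "x \<in> S" "y \<in> R" "z \<in> P" for x y z
    using that Jac_sl2_rot_PP unfolding S_def P_def R_def by blast
  have SPP: "Jac x y z = 0" if "x \<in> S" "y \<in> P" "z \<in> P" for x y z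
    using that Jac_sl2_PP_PP unfolding S_def P_def by blast
  have RRR: "Jac x y z = 0" if "x \<in> R" "y \<in> R" "z \<in> R" for x y z
    using that Jac_rot_rot_rot unfolding R_def by blast
  have RRP: "Jac x y z = 0" if "x \<in> R" "y \<in> R" "z \<in> P" for x y z
    using that Jac_rot_rot_PP unfolding R_def P_def by blast
  have RPP: "Jac x y z = 0" if "x \<in> R" "y \<in> P" "z \<in> P" for x y z
    using that Jac_rot_PP_PP unfolding R_def P_def by blast
  have PPP: "Jac x y z = 0" if "x \<in> P" "y \<in> P" "z \<in> P" for x y z
    using that by (auto simp: P_def Jac_def br_PP_PP br_lin)
  have M: "Jac x y z = 0" if "z \<in> M" for x y z
    using that by (simp add: M_def Jac_def br_lin)
  define rank :: "cga_gen \<Rightarrow> nat" where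
    "rank a = (case a of Rot _ _ \<Rightarrow> 1 | PP _ _ \<Rightarrow> 2 | Mass \<Rightarrow> 3 | _ \<Rightarrow> 0)" for a
  have cl: "(rank a = 0 \<and> unit a \<in> S) \<or> (rank a = 1 \<and> unit a \<in> R) \<or>
      (rank a = 2 \<and> unit a \<in> P) \<or> (rank a = 3 \<and> unit a \<in> M)" if "a \<in> BB" for a
    using that
  proof (cases rule: BB_cases)
    case (5 i j)
    then have "unit a = rot i j" by (simp add: rot_less)
    with 5 have "unit a \<in> R" unfolding R_def by blast
    with 5 show ?thesis by (simp add: rank_def)
  qed (auto simp: S_def P_def M_def rank_def)
  have sorted: "Jac (unit a) (unit b) (unit c) = 0"
    if "a \<in> BB" "b \<in> BB" "c \<in> BB" "rank a \<le> rank b" "rank b \<le> rank c" for a b c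
    using cl[OF that(1)] cl[OF that(2)] cl[OF that(3)] that(4,5)
    by (elim disjE conjE) (simp_all add: SSS SSR SRR SSP SRP SPP RRR RRP RPP PPP M)
  note * = assms
  consider "rank a \<le> rank b" "rank b \<le> rank c" | "rank a \<le> rank c" "rank c \<le> rank b"
    | "rank c \<le> rank a" "rank a \<le> rank b" | "rank b \<le> rank a" "rank a \<le> rank c"
    | "rank b \<le> rank c" "rank c \<le> rank a" | "rank c \<le> rank b" "rank b \<le> rank a"
    by linarith
  then show ?thesis
  proof cases
    case 1 then show ?thesis by (rule sorted[OF *])
  next
    case 2 then show ?thesis by (rule Jac_cyc[OF Jac_swap[OF sorted[OF *(1,3,2)]]])
  next
    case 3 then show ?thesis by (rule Jac_cyc[OF sorted[OF *(3,1,2)]])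
  next
    case 4 then show ?thesis by (rule Jac_swap[OF sorted[OF *(2,1,3)]])
  next
    case 5 then show ?thesis by (rule Jac_cyc[OF Jac_cyc[OF sorted[OF *(2,3,1)]]])
  next
    case 6 then show ?thesis by (rule Jac_cyc[OF Jac_cyc[OF Jac_swap[OF sorted[OF *(3,2,1)]]]])
  qed
qed

end

sublocale cga \<subseteq> based_lie_algebra "cga_basis d k" "gen_bracket k"
proof
  fix a b c assume "a \<in> cga_basis d k" "b \<in> cga_basis d k" "c \<in> cga_basis d k"
  then show "br (unit a) (gen_bracket k b c) + br (unit b) (gen_bracket k c a) + br (unit c) (gen_bracket k a b) = 0"
    using Jac_basis[of a b c] by (simp add: Jac_def br_unit)
qed

context cga
begin

section \<open>Coordinates of brackets\<close>

text \<open>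
  The entry \<open>(p, q)\<close> of the antisymmetric matrix that represents the \<open>so(d)\<close>-part of \<open>v\<close>. In terms of it the
  action of a rotation is the matrix commutator.
\<close>

definition rcoord :: "(cga_gen \<Rightarrow> complex) \<Rightarrow> nat \<Rightarrow> nat \<Rightarrow> complex" where
  "rcoord v p q = (if p < q then v (Rot p q) else if q < p then - v (Rot q p) else 0)"

lemma rcoord_lin: "rcoord 0 p q = 0" "rcoord (x + y) p q = rcoord x p q + rcoord y p q" "rcoord (scal c x) p q = c * rcoord x p q"
  "rcoord (- x) p q = - rcoord x p q" "rcoord (x - y) p q = rcoord x p q - rcoord y p q"
  by (auto simp: rcoord_def pointwise)

lemma rcoord_anti: "rcoord v q p = - rcoord v p q"
  by (auto simp: rcoord_def)

lemma rcoord_self: "rcoord v p p = 0"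
  by (simp add: rcoord_def)

lemma rot_coord [simp]: "rot i j CC = 0" "rot i j DD = 0" "rot i j HH = 0" "rot i j Mass = 0" "rot i j (PP n p) = 0"
  by (auto simp: rot_eq unit_apply pointwise)

lemma rcoord_rot: "rcoord (rot i j) p q = kdelta i p * kdelta j q - kdelta i q * kdelta j p"
  by (auto simp: rcoord_def rot_eq unit_apply pointwise kdelta_def)

lemma rcoord_unit [simp]: "rcoord (unit CC) p q = 0" "rcoord (unit DD) p q = 0" "rcoord (unit HH) p q = 0" "rcoord (unit Mass) p q = 0"
  "rcoord (unit (PP n i)) p q = 0"
  by (auto simp: rcoord_def unit_apply)

lemma unit_coord [simp]: "unit a a = 1" "a \<noteq> b \<Longrightarrow> unit a b = 0"
  by (auto simp: unit_apply)

lemma unit_PP: "unit (PP n i) (PP m j) = kdelta n m * kdelta i j"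
  by (auto simp: unit_apply kdelta_def)

text \<open>
  All formulas below are linear in \<open>v\<close> and hence need to be checked only on generators.
\<close>

lemma BB_induct [consumes 1, case_names zero add scal CC DD HH Mass rot PP]:
  assumes v: "v \<in> carrier" and "P 0"
    "\<And>x y. x \<in> carrier \<Longrightarrow> y \<in> carrier \<Longrightarrow> P x \<Longrightarrow> P y \<Longrightarrow> P (x + y)"
    "\<And>c x. x \<in> carrier \<Longrightarrow> P x \<Longrightarrow> P (scal c x)"
    and un: "P (unit CC)" "P (unit DD)" "P (unit HH)" "P (unit Mass)"
    "\<And>i j. idx i \<Longrightarrow> idx j \<Longrightarrow> i \<noteq> j \<Longrightarrow> P (rot i j)"
    "\<And>n i. n \<le> two_ell k \<Longrightarrow> idx i \<Longrightarrow> P (unit (PP n i))"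
  shows "P v"
  using v
proof (induction rule: carrier_induct)
  case (unit a)
  then show ?case
  proof (cases rule: BB_cases)
    case (5 i j)
    then have "unit a = rot i j" by (simp add: rot_less)
    with 5 un(5)[of i j] show ?thesis by simp
  qed (use un in auto)
qed (use assms in auto)

lemma coord_DD:
  assumes "v \<in> carrier"
  shows "br (unit DD) v CC = - 2 * v CC" "br (unit DD) v DD = 0" "br (unit DD) v HH = 2 * v HH"
    "br (unit DD) v Mass = 0" "rcoord (br (unit DD) v) p q = 0"
    "n \<le> two_ell k \<Longrightarrow> idx i \<Longrightarrow> br (unit DD) v (PP n i) = (of_nat (two_ell k) - 2 * of_nat n) * v (PP n i)"
  using assms
proof (induction rule: BB_induct)
  case (PP m j)
  { case 6 then show ?case using PP by (simp add: br_DD_PP pointwise unit_PP) (simp add: kdelta_def) }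
qed (simp_all add: br_lin pointwise rcoord_lin rcoord_rot br_DD_PP, (simp_all add: algebra_simps)?)

lemma coord_HH:
  assumes "v \<in> carrier"
  shows "br (unit HH) v CC = 0" "br (unit HH) v DD = - v CC" "br (unit HH) v HH = - 2 * v DD"
    "br (unit HH) v Mass = 0" "rcoord (br (unit HH) v) p q = 0"
  using assms
  by (induction rule: BB_induct) (simp_all add: br_lin pointwise rcoord_lin rcoord_rot br_HH_PP)

lemma coord_CC:
  assumes "v \<in> carrier"
  shows "br (unit CC) v CC = 2 * v DD" "br (unit CC) v DD = v HH" "br (unit CC) v HH = 0"
    "br (unit CC) v Mass = 0" "rcoord (br (unit CC) v) p q = 0"
  using assms
  by (induction rule: BB_induct) (simp_all add: br_lin pointwise rcoord_lin rcoord_rot br_CC_PP)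

lemma coord_rot:
  assumes "v \<in> carrier" "idx i" "idx j"
  shows "br (rot i j) v CC = 0" "br (rot i j) v DD = 0" "br (rot i j) v HH = 0" "br (rot i j) v Mass = 0"
    "n \<le> two_ell k \<Longrightarrow> idx p \<Longrightarrow> br (rot i j) v (PP n p) = kdelta i p * v (PP n j) - kdelta j p * v (PP n i)"
    "idx p \<Longrightarrow> idx q \<Longrightarrow> rcoord (br (rot i j) v) p q = kdelta i p * rcoord v j q - kdelta j p * rcoord v i q
      - kdelta j q * rcoord v p i + kdelta i q * rcoord v p j"
  using assms
proof (induction rule: BB_induct)
  case (PP m r)
  { case 5 then show ?case using PP by (simp add: br_rot_PP pointwise unit_PP algebra_simps kdelta_commute) }
qed (simp_all add: br_lin pointwise rcoord_lin rcoord_rot br_rot_PP br_rot_rot, (simp_all add: algebra_simps kdelta_commute)?)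

lemma coord_PP:
  assumes "v \<in> carrier" "n \<le> two_ell k" "idx i"
  shows "br (unit (PP n i)) v (PP n i) = - (of_nat (two_ell k) - 2 * of_nat n) * v DD"
    "br (unit (PP n i)) v (PP (Suc n) i) = - (of_nat (two_ell k) - of_nat n) * v CC"
    "1 \<le> n \<Longrightarrow> br (unit (PP n i)) v (PP (n - 1) i) = of_nat n * v HH"
    "idx j \<Longrightarrow> j \<noteq> i \<Longrightarrow> br (unit (PP n i)) v (PP n j) = - rcoord v j i"
    "br (unit (PP n i)) v Mass = mass_coeff k n * v (PP (two_ell k - n) i)"
  using assms
proof (induction rule: BB_induct)
  case (PP m r)
  { case 5
    have "kdelta (n + m) (two_ell k) = kdelta m (two_ell k - n)" using 5 by (auto simp: kdelta_def)
    then show ?case using PP 5 by (simp add: br_PP_PP pointwise unit_PP algebra_simps kdelta_commute) }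
qed (simp_all add: br_lin pointwise rcoord_lin rcoord_rot br_rot_PP br_PP_sl2 br_CC_PP br_HH_PP br_DD_PP br_PP_PP unit_PP, (simp_all add: algebra_simps kdelta_commute)?, (auto simp: kdelta_def)?)

lemma carrier_eqI:
  assumes "v \<in> carrier" "v' \<in> carrier" "v CC = v' CC" "v DD = v' DD" "v HH = v' HH" "v Mass = v' Mass"
    "\<And>n i. n \<le> two_ell k \<Longrightarrow> idx i \<Longrightarrow> v (PP n i) = v' (PP n i)"
    "\<And>p q. idx p \<Longrightarrow> idx q \<Longrightarrow> p \<noteq> q \<Longrightarrow> rcoord v p q = rcoord v' p q"
  shows "v = v'"
proof
  fix a
  show "v a = v' a"
  proof (cases "a \<in> BB")
    case True
    then show ?thesis
    proof (cases rule: BB_cases)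
      case (5 i j)
      then show ?thesis using assms(8)[of i j] by (simp add: rcoord_def)
    qed (use assms in auto)
  next
    case False
    then show ?thesis using assms(1,2) by (simp add: carrier_def)
  qed
qed

text \<open>
  Different \<open>P\<close>-coordinates of the brackets \<open>[P\<^sub>n\<^sub>i, v]\<close> at the bottom of the ladder show the \<open>\<s>\<close>-coordinates of \<open>v\<close>, and the nondegenerate
  pairing shows its \<open>P\<close>-coordinates, so only a mass part can centralize. The coefficient \<open>2\<ell>\<close> at \<open>D\<close> is nonzero since \<open>2\<ell>\<close> is odd.
\<close>

lemma centralizer_PP:
  assumes v: "v \<in> carrier" and c: "\<And>n i. n \<le> two_ell k \<Longrightarrow> idx i \<Longrightarrow> br (unit (PP n i)) v = 0"
    and M: "v Mass = 0" and d: "1 \<le> d"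
  shows "v = 0"
proof (rule carrier_eqI[OF v carrier_zero])
  have i: "idx 1" using d by (simp add: idx_def)
  have nz: "of_nat (two_ell k) \<noteq> (0 :: complex)" by (simp only: of_nat_eq_0_iff)
  show "v DD = 0 DD"
    using coord_PP(1)[OF v, of 0 1] c[of 0 1] i nz by (simp add: pointwise del: of_nat_add of_nat_Suc of_nat_mult)
  show "v CC = 0 CC"
    using coord_PP(2)[OF v, of 0 1] c[of 0 1] i nz by (simp add: pointwise del: of_nat_add of_nat_Suc of_nat_mult)
  show "v HH = 0 HH" using coord_PP(3)[OF v, of 1 1] c[of 1 1] i by (simp add: pointwise)
  show "v Mass = 0 Mass" using M by (simp add: pointwise)
  show "v (PP n i) = 0 (PP n i)" if "n \<le> two_ell k" "idx i" for n i
    using coord_PP(5)[OF v, of "two_ell k - n" i] c[of "two_ell k - n" i] that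
    by (simp add: pointwise mass_coeff_def)
  show "rcoord v p q = rcoord 0 p q" if "idx p" "idx q" "p \<noteq> q" for p q
    using coord_PP(4)[OF v, of 0 q p] c[of 0 q] that by (simp add: pointwise rcoord_lin)
qed

text \<open>
  A rotation generator has the eigenvalues \<open>0\<close> and \<open>\<plusminus>\<i>\<close> on the whole algebra, since only vectors
  and antisymmetric matrices occur.
\<close>

lemma rot_cubed:
  assumes "idx i" "idx j" "i \<noteq> j"
  shows "br (rot i j) (br (rot i j) (br (rot i j) v)) = - br (rot i j) v"
proof -
  have *: "br (rot i j) (br (rot i j) (br (rot i j) v)) = - br (rot i j) v" if v: "v \<in> carrier" for v
    by (rule carrier_eqI)
      (use assms v in \<open>auto intro: carrier_minus simp: coord_rot pointwise rcoord_lin kdelta_def rcoord_self rcoord_anti[of v j i]\<close>)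
  show ?thesis using *[OF proj_carrier, of v] by (simp add: brD(3))
qed

section \<open>Reduction to cocycles that vanish on the Levi factor\<close>

text \<open>
  The generators \<open>C, D, H, M\<^sub>i\<^sub>j\<close> of the Levi factor \<open>sl\<^sub>2 \<oplus> so(d)\<close>.
\<close>

definition levi :: "cga_gen set" where
  "levi = {a \<in> BB. case a of PP _ _ \<Rightarrow> False | Mass \<Rightarrow> False | _ \<Rightarrow> True}"

lemma levi_subset: "levi \<subseteq> BB"
  by (auto simp: levi_def)

lemma levi_cases:
  assumes "a \<in> levi"
  obtains "a = CC" | "a = DD" | "a = HH" | i j where "a = Rot i j" "idx i" "idx j" "i < j"
  using assms by (cases a) (auto simp: levi_def)

lemma radical_cases:
  assumes "a \<in> BB" "a \<notin> levi"
  obtains "a = Mass" | n i where "a = PP n i" "n \<le> two_ell k" "idx i"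
  using assms by (cases a) (auto simp: levi_def)

lemma mem_levi [simp]: "CC \<in> levi" "DD \<in> levi" "HH \<in> levi" "Rot i j \<in> levi \<longleftrightarrow> idx i \<and> idx j \<and> i < j"
  "PP n i \<notin> levi" "Mass \<notin> levi"
  by (auto simp: levi_def)

text \<open>
  Squared lengths of the generators. On the \<open>P\<close>-ladder they are forced, up to a factor, by the
  requirement that \<open>-C\<close> be adjoint to \<open>H\<close>; the value \<open>2\<close> at \<open>D\<close> comes from the same requirement on \<open>sl\<^sub>2\<close>.
\<close>

definition gen_weight :: "cga_gen \<Rightarrow> real" where
  "gen_weight a = (case a of DD \<Rightarrow> 2 | PP n i \<Rightarrow> fact n * fact (two_ell k - n) | _ \<Rightarrow> 1)"

lemma gen_weight_pos: "gen_weight a > 0"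
  by (auto simp: gen_weight_def split: cga_gen.split)

lemma gen_weight_simps [simp]: "gen_weight CC = 1" "gen_weight DD = 2" "gen_weight HH = 1" "gen_weight (Rot i j) = 1" "gen_weight Mass = 1"
  "gen_weight (PP n i) = fact n * fact (two_ell k - n)"
  by (simp_all add: gen_weight_def)

lemma rot_apply_Rot: "r < s \<Longrightarrow> rot p q (Rot r s) = kdelta p r * kdelta q s - kdelta q r * kdelta p s"
  using rcoord_rot[of p q r s] by (simp add: rcoord_def)

lemma cnj_kdelta [simp]: "cnj (kdelta i j) = kdelta i j"
  by (simp add: kdelta_def)

lemma star_DD:
  assumes "a \<in> BB" "c \<in> BB"
  shows "gen_bracket k DD a c * of_real (gen_weight c) = 1 * cnj (gen_bracket k DD c a) * of_real (gen_weight a)"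
  using assms
  by (elim BB_cases) (auto simp: cga_scale_eq gen_vec_eq pointwise unit_apply ell_def)

lemma gen_weight_PP_Suc:
  assumes "Suc n \<le> two_ell k"
  shows "of_nat (Suc n) * (fact n * fact (two_ell k - n)) =
    (of_nat (two_ell k) - of_nat n) * (fact (Suc n) * fact (two_ell k - Suc n) :: complex)"
proof -
  have *: "two_ell k - n = Suc (two_ell k - Suc n)" using assms by simp
  have "of_nat (two_ell k) - of_nat n = (of_nat (two_ell k - n) :: complex)" using assms by (simp add: of_nat_diff)
  then show ?thesis unfolding * by (simp add: * algebra_simps)
qed

lemma star_HH:
  assumes "a \<in> BB" "c \<in> BB"
  shows "gen_bracket k HH a c * of_real (gen_weight c) = - 1 * cnj (gen_bracket k CC c a) * of_real (gen_weight a)"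
proof -
  have "gen_bracket k HH (PP n i) (PP m j) * of_real (gen_weight (PP m j))
      = - 1 * cnj (gen_bracket k CC (PP m j) (PP n i)) * of_real (gen_weight (PP n i))"
    if "n \<le> two_ell k" "m \<le> two_ell k" for n m i j
  proof (cases "n = Suc m \<and> i = j")
    case True
    then show ?thesis
      using gen_weight_PP_Suc[of m] that
      by (simp add: cga_scale_eq gen_vec_eq pointwise unit_apply two_ell_eq del: fact_Suc of_nat_Suc)
        (simp add: left_diff_distrib)
  next
    case False
    then have "of_nat n * unit (PP (n - 1) i) (PP m j) = (0 :: complex)" "unit (PP (Suc m) j) (PP n i) = 0"
      by (auto simp: unit_apply)
    then show ?thesis by (simp add: cga_scale_eq gen_vec_eq pointwise)
  qed
  then show ?thesis
    using assms by (elim BB_cases) (auto simp: cga_scale_eq gen_vec_eq pointwise unit_apply)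
qed

lemma star_CC:
  assumes "a \<in> BB" "c \<in> BB"
  shows "gen_bracket k CC a c * of_real (gen_weight c) = - 1 * cnj (gen_bracket k HH c a) * of_real (gen_weight a)"
  using arg_cong[OF star_HH[OF assms(2,1)], of cnj] by simp

lemma star_Rot:
  assumes "a \<in> BB" "c \<in> BB"
  shows "gen_bracket k (Rot i j) a c * of_real (gen_weight c) = - 1 * cnj (gen_bracket k (Rot i j) c a) * of_real (gen_weight a)"
  using assms
  by (elim BB_cases)
    (simp_all add: cga_scale_eq gen_vec_eq pointwise rot_apply_Rot unit_PP algebra_simps kdelta_commute,
     simp_all add: unit_apply kdelta_def)

lemma star_exists:
  assumes "s \<in> levi"
  shows "\<exists>s'\<in>BB. \<exists>\<sigma>. \<forall>a\<in>BB. \<forall>c\<in>BB.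
      gen_bracket k s a c * of_real (gen_weight c) = \<sigma> * cnj (gen_bracket k s' c a) * of_real (gen_weight a)"
  using assms
proof (cases rule: levi_cases)
  case 1
  then show ?thesis using star_CC by (intro bexI[of _ HH] exI[of _ "-1"]) auto
next
  case 2
  then show ?thesis using star_DD by (intro bexI[of _ DD] exI[of _ 1]) auto
next
  case 3
  then show ?thesis using star_HH by (intro bexI[of _ CC] exI[of _ "-1"]) auto
next
  case (4 i j)
  then show ?thesis using star_Rot by (intro bexI[of _ "Rot i j"] exI[of _ "-1"]) auto
qed

definition levi_vecs where "levi_vecs = {unit CC, unit DD, unit HH} \<union> {rot i j | i j. idx i \<and> idx j \<and> i \<noteq> j}"

lemma unit_levi: "s \<in> levi \<Longrightarrow> unit s \<in> levi_vecs"
proof (erule levi_cases)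
  fix i j assume "s = Rot i j" "idx i" "idx j" "i < j"
  then have "unit s = rot i j" "idx i" "idx j" "i \<noteq> j" by (simp_all add: rot_less)
  then show "unit s \<in> levi_vecs" unfolding levi_vecs_def by blast
qed (simp_all add: levi_vecs_def)

lemma levi_vecs_unit:
  assumes "x \<in> levi_vecs" shows "\<exists>s c. s \<in> levi \<and> x = scal c (unit s)"
proof -
  have "\<exists>s c. s \<in> levi \<and> rot i j = scal c (unit s)" if "idx i" "idx j" "i \<noteq> j" for i j
  proof (cases "i < j")
    case True
    with that show ?thesis by (intro exI[of _ "Rot i j"] exI[of _ 1]) (simp add: rot_less)
  next
    case False
    with that show ?thesis
      by (intro exI[of _ "Rot j i"] exI[of _ "-1"]) (simp add: rot_anti[of i j] rot_less scal_minus_left)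
  qed
  moreover have "\<exists>s c. s \<in> levi \<and> unit a = scal c (unit s)" if "a \<in> levi" for a
    using that by (intro exI[of _ a] exI[of _ 1]) simp
  ultimately show ?thesis using assms unfolding levi_vecs_def by (elim UnE insertE emptyE CollectE exE conjE) simp_all
qed

lemma bracket_levi_levi:
  assumes "s \<in> levi" "t \<in> levi" "c \<notin> levi" shows "gen_bracket k s t c = 0"
proof (cases "c \<in> BB")
  case True
  then show ?thesis
    using assms(3)
    by (rule radical_cases) (use assms(1,2) in \<open>elim levi_cases; simp add: cga_scale_eq gen_vec_eq pointwise unit_apply\<close>)+
next
  case False
  then show ?thesis using N_carrier[of s t] assms levi_subset by (auto simp: carrier_def)
qed

lemma bracket_levi_radical:
  assumes "s \<in> levi" "b \<in> BB" "b \<notin> levi" "t \<in> levi" shows "gen_bracket k s b t = 0"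
  using assms(2,3)
  by (rule radical_cases) (use assms(1,4) in \<open>elim levi_cases; simp add: cga_scale_eq gen_vec_eq pointwise unit_apply\<close>)+

lemma third_index:
  assumes "d \<ge> 3" obtains r where "idx r" "r \<noteq> i" "r \<noteq> j"
proof -
  have "\<not> {1, 2, 3} \<subseteq> {i, j}"
    using card_mono[of "{i, j}" "{1, 2, 3}"] card_insert_le_m1[of 2 "{j}" i] by auto
  then obtain r where "r \<in> {1, 2, 3}" "r \<notin> {i, j}" by blast
  then show ?thesis using that[of r] assms by (auto simp: idx_def)
qed

text \<open>
  A rotation \<open>rot i j\<close> is the bracket of \<open>rot i r\<close> and \<open>rot r j\<close> for a third index \<open>r\<close>.
\<close>

lemma perfect:
  assumes d: "d \<ge> 3" and x: "x \<in> levi_vecs"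
  shows "\<exists>y\<in>levi_vecs. \<exists>z\<in>levi_vecs. \<exists>c. x = scal c (br y z)"
proof -
  consider "x = unit CC" | "x = unit DD" | "x = unit HH" | i j where "x = rot i j" "idx i" "idx j" "i \<noteq> j"
    using x unfolding levi_vecs_def by blast
  then show ?thesis
  proof cases
    case 1
    then show ?thesis
      by (intro bexI[of _ "unit DD"] bexI[of _ "unit CC"] exI[of _ "-1/2"]) (auto simp: levi_vecs_def scal_minus_right scal_minus_left)
  next
    case 2
    then show ?thesis
      by (intro bexI[of _ "unit CC"] bexI[of _ "unit HH"] exI[of _ 1]) (auto simp: levi_vecs_def)
  next
    case 3
    then show ?thesis
      by (intro bexI[of _ "unit DD"] bexI[of _ "unit HH"] exI[of _ "1/2"]) (auto simp: levi_vecs_def)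
  next
    case (4 i j)
    obtain r where r: "idx r" "r \<noteq> i" "r \<noteq> j" using third_index[OF d] by blast
    have "br (rot i r) (rot r j) = rot i j"
      using 4 r by (simp add: br_rot_rot)
    moreover have "rot i r \<in> levi_vecs" "rot r j \<in> levi_vecs" using 4 r unfolding levi_vecs_def by blast+
    ultimately show ?thesis using 4
      by (intro bexI[of _ "rot i r"] bexI[of _ "rot r j"] exI[of _ 1]) auto
  qed
qed

text \<open>
  After averaging, \<open>F(x, -) = [u(x), -]\<close> for each generator \<open>x = [y, z]\<close> of the Levi factor, with
  \<open>u(x) = F(y, z)\<close>. The map that is \<open>u\<close> on the Levi factor and \<open>0\<close> on the radical has a coboundary
  which agrees with \<open>F\<close> if one argument is in the Levi factor and the other in the radical. If both are in
  the Levi factor, the value of the remaining cocycle centralizes the \<open>P\<^sub>n\<^sub>i\<close> by the cocycle identity; it has no mass coordinate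
  either, because \<open>u\<close> is chosen without one.
\<close>

lemma relative_cocycle:
  assumes d: "d \<ge> 3" and c: "cocycle F"
  shows "\<exists>\<phi>. endo \<phi> \<and> (\<forall>s\<in>levi. \<forall>v. F (unit s) v - cob \<phi> (unit s) v = 0)"
proof -
  obtain \<phi>\<^sub>0 where \<phi>\<^sub>0: "endo \<phi>\<^sub>0" and inv0: "\<forall>s\<in>levi. \<forall>x y. Lie2 (unit s) (\<lambda>x y. F x y - cob \<phi>\<^sub>0 x y) x y = 0"
    using cohomologous_invariant[OF c gen_weight_pos levi_subset star_exists] by blast
  define G where "G = (\<lambda>x y. F x y - cob \<phi>\<^sub>0 x y)"
  have cG: "cocycle G" unfolding G_def by (rule cocycle_diff[OF c cocycle_cob[OF \<phi>\<^sub>0]])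
  note G = cocycle_alt2[OF cG]
  have inv: "Lie2 x G y z = 0" if xS: "x \<in> levi_vecs" for x y z
  proof -
    obtain s a where s: "s \<in> levi" "x = scal a (unit s)" using levi_vecs_unit[OF xS] by blast
    have "Lie2 (scal a (unit s)) G y z = scal a (Lie2 (unit s) G y z)"
      by (simp add: Lie2_def br_lin alt2D[OF G] scal_diff_right)
    then show ?thesis using inv0 s by (simp add: G_def)
  qed
  have brk: "G (br x y) z = br (G x y) z" if "x \<in> levi_vecs" "y \<in> levi_vecs" for x y z
    by (rule invariant_cocycle_bracket[OF cG inv[OF that(1)] inv[OF that(2)]])
  have "\<exists>v. v \<in> carrier \<and> v Mass = 0 \<and> (\<forall>z. G (unit s) z = br v z)" if sS: "s \<in> levi" for s
  proof -
    obtain y z a where yz: "y \<in> levi_vecs" "z \<in> levi_vecs" "unit s = scal a (br y z)"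
      using perfect[OF d unit_levi[OF sS]] by blast
    define v where "v = scal a (G y z)"
    have v: "v \<in> carrier" unfolding v_def by (intro carrier_scal alt2D[OF G])
    have vz: "G (unit s) w = br v w" for w
      unfolding yz(3) v_def by (simp add: alt2D(9)[OF G] brk yz br_lin)
    show ?thesis
    proof (intro exI conjI allI)
      \<comment> \<open>Dropping the central part of \<open>v\<close> does not change its brackets.\<close>
      show "v - scal (v Mass) (unit Mass) \<in> carrier"
        by (intro carrier_diff v carrier_scal carrier_unit) simp
      show "(v - scal (v Mass) (unit Mass)) Mass = 0" by (simp add: pointwise)
      show "G (unit s) w = br (v - scal (v Mass) (unit Mass)) w" for w
        by (simp add: vz br_lin)
    qed
  qed
  then obtain u where u: "\<And>s. s \<in> levi \<Longrightarrow> u s \<in> carrier" "\<And>s. s \<in> levi \<Longrightarrow> u s Mass = 0"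
    "\<And>s z. s \<in> levi \<Longrightarrow> G (unit s) z = br (u s) z" by metis
  obtain \<psi> where \<psi>: "endo \<psi>" and \<psi>u: "\<And>a. a \<in> BB \<Longrightarrow> \<psi> (unit a) = (if a \<in> levi then u a else 0)"
    by (rule endo_extend[of "\<lambda>a. if a \<in> levi then u a else 0"]) (use u in auto)
  define H where "H = (\<lambda>x y. G x y - cob \<psi> x y)"
  have cH: "cocycle H" unfolding H_def by (rule cocycle_diff[OF cG cocycle_cob[OF \<psi>]])
  note H = cocycle_alt2[OF cH]
  have van_h: "\<theta> w = 0" if "endo \<theta>" "\<And>b. b \<in> BB \<Longrightarrow> b \<notin> levi \<Longrightarrow> \<theta> (unit b) = 0" "\<And>t. t \<in> levi \<Longrightarrow> w t = 0" for \<theta> w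
  proof -
    have "scal (w a) (\<theta> (unit a)) = 0" if "a \<in> BB" for a
      using \<open>a \<in> BB\<close> that(1) \<open>\<And>b. b \<in> BB \<Longrightarrow> b \<notin> levi \<Longrightarrow> \<theta> (unit b) = 0\<close> \<open>\<And>t. t \<in> levi \<Longrightarrow> w t = 0\<close>
      by (cases "a \<in> levi") auto
    then show ?thesis using endo_expand[OF that(1), of w] by simp
  qed
  have van_S: "\<theta> w = 0" if "endo \<theta>" "\<And>b. b \<in> levi \<Longrightarrow> \<theta> (unit b) = 0" "\<And>t. t \<in> BB \<Longrightarrow> t \<notin> levi \<Longrightarrow> w t = 0" for \<theta> w
  proof -
    have "scal (w a) (\<theta> (unit a)) = 0" if "a \<in> BB" for a
      using \<open>a \<in> BB\<close> \<open>\<And>b. b \<in> levi \<Longrightarrow> \<theta> (unit b) = 0\<close> \<open>\<And>t. t \<in> BB \<Longrightarrow> t \<notin> levi \<Longrightarrow> w t = 0\<close>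
      by (cases "a \<in> levi") auto
    then show ?thesis using endo_expand[OF that(1), of w] by simp
  qed
  have Hh: "H (unit s) (unit b) = 0" if s: "s \<in> levi" and b: "b \<in> BB" "b \<notin> levi" for s b
  proof -
    have sB: "s \<in> BB" using s levi_subset by blast
    have "\<psi> (br (unit s) (unit b)) = 0"
      by (rule van_h[OF \<psi>]) (use \<psi>u s b sB in \<open>simp_all add: br_unit bracket_levi_radical\<close>)
    then show ?thesis
      using br_anti[of "u s" "unit b"]
      by (simp add: H_def cob_def \<psi>u sB s b u(3) br_lin)
  qed
  have Hw: "H (unit s) w = 0" if "s \<in> levi" "\<And>t. t \<in> levi \<Longrightarrow> w t = 0" for s w
    by (rule van_h[OF alt2_right[OF H] _ that(2)]) (rule Hh[OF that(1)])
  have wH: "H w (unit b) = 0" if "b \<in> BB" "b \<notin> levi" "\<And>t. t \<in> BB \<Longrightarrow> t \<notin> levi \<Longrightarrow> w t = 0" for w b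
    by (rule van_S[OF alt2_left[OF H] _ that(3)]) (rule Hh[OF _ that(1,2)])
  have HS: "H (unit s) (unit t) = 0" if s: "s \<in> levi" and t: "t \<in> levi" for s t
  proof (rule centralizer_PP)
    have sB: "s \<in> BB" "t \<in> BB" using s t levi_subset by blast+
    show "H (unit s) (unit t) \<in> carrier" by (rule alt2D[OF H])
    show "1 \<le> d" using d by simp
    show "br (unit (PP n i)) (H (unit s) (unit t)) = 0" if n: "n \<le> two_ell k" "idx i" for n i
    proof -
      have P: "PP n i \<in> BB" "PP n i \<notin> levi" using n by auto
      have 1: "H (br (unit s) (unit t)) (unit (PP n i)) = 0"
        by (rule wH[OF P]) (simp add: br_unit sB bracket_levi_levi s t)
      have 2: "H (br (unit s) (unit (PP n i))) (unit t) = 0"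
        unfolding alt2_anti[OF H, of _ "unit t"]
        by (simp add: Hw[OF t] br_unit[OF sB(1) P(1)] bracket_levi_radical[OF s P])
      have 3: "H (br (unit t) (unit (PP n i))) (unit s) = 0"
        unfolding alt2_anti[OF H, of _ "unit s"]
        by (simp add: Hw[OF s] br_unit[OF sB(2) P(1)] bracket_levi_radical[OF t P])
      show ?thesis
        using cocycle_eq[OF cH, of "unit s" "unit t" "unit (PP n i)"]
        unfolding 1 2 3 Hh[OF s P] Hh[OF t P] by (simp add: br_lin)
    qed
    have M0: "br (unit r) v Mass = 0" if "r \<in> levi" "v \<in> carrier" for r v
      using that(1) by (rule levi_cases) (use that(2) coord_DD coord_CC coord_HH coord_rot(4) rot_less in \<open>simp_all flip: rot_less\<close>)
    have "\<psi> (br (unit s) (unit t)) Mass = 0"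
    proof -
      have "\<psi> (br (unit s) (unit t)) Mass = (\<Sum>a\<in>BB. br (unit s) (unit t) a * \<psi> (unit a) Mass)"
        using endo_expand[OF \<psi>, of "br (unit s) (unit t)"] by (simp add: sum_fun_apply pointwise)
      also have "\<dots> = 0"
        by (rule sum.neutral) (simp add: \<psi>u u(2) pointwise)
      finally show ?thesis .
    qed
    moreover have "G (unit s) (unit t) Mass = 0"
      using br_anti[of "u s" "unit t"] M0[OF t u(1)[OF s]] by (simp add: u(3) s pointwise)
    ultimately show "H (unit s) (unit t) Mass = 0"
      using M0[OF s u(1)[OF t]] M0[OF t u(1)[OF s]] by (simp add: H_def cob_def \<psi>u sB s t pointwise)
  qed
  have "H (unit s) v = 0" if "s \<in> levi" for s v
    by (rule endo_eqI[OF alt2_right[OF H] endo_zero]) (use Hh HS that in blast)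
  then have "F (unit s) v - cob (\<lambda>x. \<phi>\<^sub>0 x + \<psi> x) (unit s) v = 0" if "s \<in> levi" for s v
    using that by (simp add: H_def G_def cob_add diff_diff_eq)
  with endo_add[OF \<phi>\<^sub>0 \<psi>] show ?thesis by blast
qed

end

section \<open>Cocycles that vanish on the Levi factor\<close>

lemma chain_zero:
  fixes h :: "nat \<Rightarrow> complex"
  assumes rec: "\<And>c. c < N \<Longrightarrow> A c * h c + B c * h (Suc c) = 0"
    and nz: "\<And>c. c < N \<Longrightarrow> A c \<noteq> 0" "\<And>c. c < N \<Longrightarrow> B c \<noteq> 0"
    and a: "a \<le> N" "h a = 0" and c: "c \<le> N"
  shows "h c = 0"
proof (cases "a \<le> c")
  case True
  then show ?thesis using c
  proof (induction c rule: dec_induct)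
    case (step n)
    then show ?case using rec[of n] nz(2)[of n] by simp
  qed (rule a(2))
next
  case False
  then have "c \<le> a" by simp
  then show ?thesis
  proof (induction c rule: inc_induct)
    case (step n)
    then show ?case using rec[of n] nz(1)[of n] a(1) by simp
  qed (rule a(2))
qed

lemma mass_coeff_nonzero: "mass_coeff k m \<noteq> 0"
  by (simp add: mass_coeff_def del: fact_Suc)

locale relative_cga = cga +
  fixes G
  assumes d: "d \<ge> 3" and cG: "cocycle G" and rel: "\<And>s v. s \<in> levi \<Longrightarrow> G (unit s) v = 0"
begin

lemmas G = cocycle_alt2[OF cG]

lemma vanish_levi: "x \<in> levi_vecs \<Longrightarrow> G x v = 0"
  using levi_vecs_unit[of x] rel alt2D(9)[OF G] by force

text \<open>
  With \<open>x\<close> in the Levi factor, three of the six terms of the cocycle identity drop out and the others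
  express equivariance.
\<close>

lemma equivariant:
  assumes "x \<in> levi_vecs"
  shows "br x (G y z) = G (br x y) z + G y (br x z)"
  using cocycle_eq[OF cG, of x y z] alt2_anti[OF G, of "br x z" y] alt2_anti[OF G, of "br y z" x]
  by (simp add: vanish_levi[OF assms] br_lin algebra_simps eq_neg_iff_add_eq_0)

abbreviation P where "P n i \<equiv> unit (PP n i)"

lemma G_carrier [simp]: "G x y \<in> carrier"
  by (rule alt2D[OF G])

lemma levi_vecs_sl2 [simp]: "unit CC \<in> levi_vecs" "unit DD \<in> levi_vecs" "unit HH \<in> levi_vecs"
  by (simp_all add: levi_vecs_def)

lemma levi_vecs_rot: "idx i \<Longrightarrow> idx j \<Longrightarrow> i \<noteq> j \<Longrightarrow> rot i j \<in> levi_vecs"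
  unfolding levi_vecs_def by blast

lemmas G_lin = alt2D(1,2,5,6,7,8,9,12,13,14)[OF G]

lemma equivariant_DD:
  assumes "m \<le> two_ell k" "n \<le> two_ell k" "idx i" "idx j"
  shows "br (unit DD) (G (P m i) (P n j)) =
    scal (2 * (of_nat (two_ell k) - of_nat m - of_nat n)) (G (P m i) (P n j))"
proof -
  have "br (unit DD) (G (P m i) (P n j)) = scal (of_nat (two_ell k) - 2 * of_nat m) (G (P m i) (P n j))
      + scal (of_nat (two_ell k) - 2 * of_nat n) (G (P m i) (P n j))"
    using assms by (simp only: equivariant[OF levi_vecs_sl2(2)] br_DD_PP G_lin)
  also have "\<dots> = scal (2 * (of_nat (two_ell k) - of_nat m - of_nat n)) (G (P m i) (P n j))"
    unfolding scal_add_left[symmetric] by (rule arg_cong[where f = "\<lambda>c. scal c _"]) (simp add: algebra_simps)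
  finally show ?thesis .
qed

lemma equivariant_HH:
  assumes "m \<le> two_ell k" "n \<le> two_ell k" "idx i" "idx j"
  shows "br (unit HH) (G (P m i) (P n j)) =
    - scal (of_nat m) (G (P (m - 1) i) (P n j)) - scal (of_nat n) (G (P m i) (P (n - 1) j))"
  using assms by (simp only: equivariant[OF levi_vecs_sl2(3)] br_HH_PP G_lin) simp

lemma equivariant_CC:
  assumes "m \<le> two_ell k" "n \<le> two_ell k" "idx i" "idx j"
  shows "br (unit CC) (G (P m i) (P n j)) =
    scal (of_nat (two_ell k) - of_nat m) (G (P (Suc m) i) (P n j))
    + scal (of_nat (two_ell k) - of_nat n) (G (P m i) (P (Suc n) j))"
  using assms by (simp only: equivariant[OF levi_vecs_sl2(1)] br_CC_PP G_lin)

text \<open>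
  Parity of \<open>D\<close>-weights: \<open>2\<ell> - 2r\<close> is odd, while the weight of the value is even.
\<close>

lemma no_PP_part:
  assumes "m \<le> two_ell k" "n \<le> two_ell k" "idx i" "idx j" "r \<le> two_ell k" "idx q"
  shows "G (P m i) (P n j) (PP r q) = 0"
proof (rule ccontr)
  assume nz: "G (P m i) (P n j) (PP r q) \<noteq> 0"
  have "(of_nat (two_ell k) - 2 * of_nat r) * G (P m i) (P n j) (PP r q)
      = 2 * (of_nat (two_ell k) - of_nat m - of_nat n) * G (P m i) (P n j) (PP r q)"
    using coord_DD(6)[OF G_carrier assms(5,6), of "P m i" "P n j"]
    unfolding equivariant_DD[OF assms(1-4)] pointwise by (rule sym)
  then have "of_nat (two_ell k) - 2 * of_nat r = (2 * (of_nat (two_ell k) - of_nat m - of_nat n) :: complex)"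
    using nz by (simp only: mult_cancel_right) simp
  then have "of_nat (two_ell k + 2 * m + 2 * n) = (of_nat (2 * two_ell k + 2 * r) :: complex)"
    by (simp add: algebra_simps)
  then have "two_ell k + 2 * m + 2 * n = 2 * two_ell k + 2 * r"
    by (simp only: of_nat_eq_iff)
  then show False by presburger
qed

text \<open>
  For \<open>X = ad M\<^sub>i\<^sub>j\<close> write \<open>A, E\<close> for the values at index pairs \<open>(i, i)\<close>, \<open>(j, j)\<close> and \<open>T\<close> for the sum of
  those at \<open>(i, j)\<close> and \<open>(j, i)\<close>. Then \<open>X A = - T\<close>, \<open>X E = T\<close>, \<open>X T = 2 (A - E)\<close>, whence \<open>X\<^sup>3 A = 4 T\<close>. But
  \<open>X\<^sup>3 A = - X A = T\<close>, so \<open>T = 0\<close>; then \<open>X A = 0\<close>, and \<open>X T = 0\<close> gives \<open>A = E\<close>.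
\<close>

lemma exchange:
  assumes "m \<le> two_ell k" "n \<le> two_ell k" "idx i" "idx j" "i \<noteq> j"
  shows "G (P m i) (P n j) = - G (P m j) (P n i)" "G (P m i) (P n i) = G (P m j) (P n j)"
    "br (rot i j) (G (P m i) (P n i)) = 0"
proof -
  let ?X = "br (rot i j)"
  have Xi: "?X (P r i) = - P r j" and Xj: "?X (P r j) = P r i" if "r \<le> two_ell k" for r
    using assms that by (simp_all add: br_rot_PP)
  note X = equivariant[OF levi_vecs_rot[OF assms(3-5)]]
  define A where "A = G (P m i) (P n i)"
  define E where "E = G (P m j) (P n j)"
  define T where "T = G (P m i) (P n j) + G (P m j) (P n i)"
  have XA: "?X A = - T"
    unfolding A_def T_def by (simp add: X Xi[OF assms(1)] Xi[OF assms(2)] G_lin)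
  have XE: "?X E = T"
    unfolding E_def T_def by (simp add: X Xj[OF assms(1)] Xj[OF assms(2)] add.commute)
  have XT: "?X T = scal 2 (A - E)"
    unfolding A_def E_def T_def br_lin
    by (simp add: X Xi[OF assms(1)] Xi[OF assms(2)] Xj[OF assms(1)] Xj[OF assms(2)] G_lin)
      (simp add: fun_eq_iff pointwise)
  have "?X (?X (?X A)) = scal 4 T"
    by (simp add: XA XT XE br_lin scal_diff_right scal_minus_right) (simp add: fun_eq_iff pointwise)
  moreover have "?X (?X (?X A)) = T"
    using rot_cubed[OF assms(3-5), of A] by (simp add: XA)
  ultimately have T0: "T = 0"
    by (simp add: fun_eq_iff pointwise)
  show "G (P m i) (P n j) = - G (P m j) (P n i)"
    using T0 unfolding T_def by (simp add: eq_neg_iff_add_eq_0)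
  show "br (rot i j) (G (P m i) (P n i)) = 0"
    using XA T0 unfolding A_def by simp
  have "scal 2 (A - E) = 0" using XT T0 by (simp add: br_lin)
  then show "G (P m i) (P n i) = G (P m j) (P n j)"
    unfolding A_def E_def by (simp add: fun_eq_iff pointwise)
qed

text \<open>
  The ladder relation satisfied by any coordinate \<open>lam\<close> that vanishes on the image of \<open>ad H\<close>.
\<close>

lemma step_HH:
  assumes lam: "\<And>x y. lam (x + y) = lam x + lam y" "\<And>c x. lam (scal c x) = c * lam x" "\<And>x. lam (- x) = - lam x"
    and z: "\<And>v. v \<in> carrier \<Longrightarrow> lam (br (unit HH) v) = 0"
    and mn: "m + n = Suc (two_ell k)" "m \<le> two_ell k" "n \<le> two_ell k" and ij: "idx i" "idx j"
  shows "of_nat m * lam (G (P (m - 1) i) (P n j)) + of_nat n * lam (G (P m i) (P (n - 1) j)) = (0 :: complex)"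
proof -
  have "br (unit HH) (G (P m i) (P n j)) =
      - (scal (of_nat m) (G (P (m - 1) i) (P n j)) + scal (of_nat n) (G (P m i) (P (n - 1) j)))"
    unfolding equivariant_HH[OF mn(2,3) ij] by simp
  then have "0 = lam (- (scal (of_nat m) (G (P (m - 1) i) (P n j)) + scal (of_nat n) (G (P m i) (P (n - 1) j))))"
    using z[OF G_carrier, of "P m i" "P n j"] by simp
  then show ?thesis unfolding lam by (metis neg_equal_0_iff_equal)
qed

lemma weight_zero:
  assumes "m \<le> two_ell k" "n \<le> two_ell k" "idx i" "idx j" "m + n \<noteq> two_ell k"
  shows "G (P m i) (P n j) DD = 0" "G (P m i) (P n j) Mass = 0" "rcoord (G (P m i) (P n j)) p q = 0"
proof -
  have "of_nat (two_ell k) \<noteq> (of_nat (m + n) :: complex)"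
    using assms(5) by (simp only: of_nat_eq_iff)
  then have "of_nat (two_ell k) - of_nat m - of_nat n \<noteq> (0 :: complex)"
    unfolding of_nat_add[of m n] diff_diff_eq by (simp only: right_minus_eq not_False_eq_True)
  then have nz: "2 * (of_nat (two_ell k) - of_nat m - of_nat n) \<noteq> (0 :: complex)"
    by (simp only: mult_eq_0_iff) simp
  note e = equivariant_DD[OF assms(1-4)]
  show "G (P m i) (P n j) DD = 0"
    using coord_DD(2)[OF G_carrier, of "P m i" "P n j"] nz unfolding e pointwise by (simp only: mult_eq_0_iff) simp
  show "G (P m i) (P n j) Mass = 0"
    using coord_DD(4)[OF G_carrier, of "P m i" "P n j"] nz unfolding e pointwise by (simp only: mult_eq_0_iff) simp
  show "rcoord (G (P m i) (P n j)) p q = 0"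
    using coord_DD(5)[OF G_carrier, of "P m i" "P n j" p q] nz unfolding e rcoord_lin by (simp only: mult_eq_0_iff) simp
qed

text \<open>
  For different vector indices the value is a bracket with a rotation. By this and by the parity
  of weights, only rotation coordinates are possible.
  By the exchange law these are symmetric in the ladder indices \<open>m\<close>, \<open>n\<close>, whereas the ladder relation between the
  two middle positions \<open>k\<close>, \<open>k + 1\<close> says that their sum is zero. Hence they vanish in the
  middle and then everywhere.
\<close>

lemma off_diagonal:
  assumes m: "m \<le> two_ell k" and n: "n \<le> two_ell k" and ij: "idx i" "idx j" "i \<noteq> j"
  shows "G (P m i) (P n j) = 0"
proof (rule carrier_eqI[OF G_carrier carrier_zero])
  obtain q where q: "idx q" "q \<noteq> i" "q \<noteq> j" using third_index[OF d] by blast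
  have "br (rot j q) (G (P m i) (P n q)) = G (P m i) (P n j)"
    unfolding equivariant[OF levi_vecs_rot[OF ij(2) q(1) q(3)[symmetric]]]
    using m n ij q by (simp add: br_rot_PP G_lin)
  then have *: "G (P m i) (P n j) = br (rot j q) (G (P m i) (P n q))" by simp
  show "G (P m i) (P n j) CC = 0 CC" "G (P m i) (P n j) DD = 0 DD" "G (P m i) (P n j) HH = 0 HH"
    "G (P m i) (P n j) Mass = 0 Mass"
    unfolding * using ij(2) q(1) by (simp_all add: coord_rot pointwise)
  show "G (P m i) (P n j) (PP r s) = 0 (PP r s)" if "r \<le> two_ell k" "idx s" for r s
    using no_PP_part[OF m n ij(1,2) that] by (simp add: pointwise)
  fix p s
  define h where "h c = rcoord (G (P c i) (P (two_ell k - c) j)) p s" for c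
  have sym: "G (P a i) (P b j) = G (P b i) (P a j)" if "a \<le> two_ell k" "b \<le> two_ell k" for a b
    using exchange(1)[OF that ij] alt2_anti[OF G, of "P a j" "P b i"] by simp
  have rec: "of_nat (Suc c) * h c + of_nat (two_ell k - c) * h (Suc c) = 0" if "c < two_ell k" for c
    using step_HH[where lam = "\<lambda>v. rcoord v p s", of "Suc c" "two_ell k - c" i j] that ij
    by (simp add: rcoord_lin coord_HH h_def Suc_diff_le del: of_nat_Suc)
  have mid: "two_ell k - Suc k = k" "two_ell k - k = Suc k" by simp_all
  have "h (Suc k) = h k"
    unfolding h_def mid using sym[of k "Suc k"] by simp
  moreover have "of_nat (Suc k) * h k + of_nat (Suc k) * h (Suc k) = 0"
    using rec[of k] unfolding mid by simp
  ultimately have "(of_nat (Suc k) + of_nat (Suc k)) * h k = 0"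
    by (simp only: distrib_right)
  then have hk: "h k = 0"
    unfolding of_nat_add[symmetric] mult_eq_0_iff of_nat_eq_0_iff by simp
  have h0: "h m = 0"
    by (rule chain_zero[OF rec _ _ _ hk m]) (simp_all del: of_nat_Suc)
  show "rcoord (G (P m i) (P n j)) p s = rcoord 0 p s"
  proof (cases "m + n = two_ell k")
    case True
    then have "two_ell k - m = n" by simp
    then show ?thesis using h0 by (simp add: h_def rcoord_lin)
  next
    case False
    then show ?thesis using weight_zero(3)[OF m n ij(1,2)] by (simp add: rcoord_lin)
  qed
qed

text \<open>
  The \<open>H\<close>-coordinate lives in weight \<open>m + n = 2k\<close>. In the middle, \<open>m = n = k\<close>, it vanishes by
  alternation, and the relation for \<open>C\<close> spreads this over the ladder.
\<close>

lemma diagonal_HH: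
  assumes "m \<le> two_ell k" "n \<le> two_ell k" "idx i"
  shows "G (P m i) (P n i) HH = 0"
proof (cases "m + n = 2 * k")
  case True
  define h where "h c = G (P c i) (P (2 * k - c) i) HH" for c
  have rec: "(of_nat (two_ell k) - of_nat c) * h (Suc c)
      + (of_nat (two_ell k) - of_nat (2 * k - Suc c)) * h c = 0" if c: "c < 2 * k" for c
  proof -
    have "br (unit CC) (G (P c i) (P (2 * k - Suc c) i)) HH = 0"
      by (rule coord_CC(3)[OF G_carrier])
    moreover have "Suc (2 * k - Suc c) = 2 * k - c" using c by simp
    ultimately show ?thesis
      using c assms(3) by (subst (asm) equivariant_CC) (simp_all add: pointwise h_def)
  qed
  have rec': "(of_nat (two_ell k) - of_nat (2 * k - Suc c)) * h c + (of_nat (two_ell k) - of_nat c) * h (Suc c) = 0"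
    if "c < 2 * k" for c
    using rec[OF that] by (simp only: add.commute)
  have nz: "of_nat (two_ell k) - of_nat c \<noteq> (0 :: complex)" if "c \<le> 2 * k" for c
  proof
    assume "of_nat (two_ell k) - of_nat c = (0 :: complex)"
    then have "of_nat (two_ell k) = (of_nat c :: complex)" by (simp only: right_minus_eq)
    then have "two_ell k = c" by (simp only: of_nat_eq_iff)
    with that show False by simp
  qed
  have "2 * k - k = k" by simp
  then have hk: "h k = 0" unfolding h_def by (simp add: alt2_self[OF G] pointwise)
  have "h m = 0"
    by (rule chain_zero[OF rec' nz nz _ hk]) (use True in auto)
  moreover have "2 * k - m = n" using True by simp
  ultimately show ?thesis by (simp add: h_def)
next
  case False
  have "2 * G (P m i) (P n i) HH = 2 * (of_nat (two_ell k) - of_nat m - of_nat n) * G (P m i) (P n i) HH"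
    using coord_DD(3)[OF G_carrier, of "P m i" "P n i"] assms by (simp add: equivariant_DD pointwise)
  moreover have "of_nat (two_ell k) - of_nat m - of_nat n \<noteq> (1 :: complex)"
  proof
    assume "of_nat (two_ell k) - of_nat m - of_nat n = (1 :: complex)"
    then have "of_nat (2 * k) = (of_nat (m + n) :: complex)" by (simp add: algebra_simps)
    then show False using False by (simp only: of_nat_eq_iff)
  qed
  moreover have "x = 0" if "2 * x = 2 * y * x" "y \<noteq> 1" for x y :: complex
    using that by simp
  ultimately show ?thesis by blast
qed

text \<open>
  Applying \<open>ad H\<close> to the value turns its \<open>D\<close>- and \<open>C\<close>-coordinates into \<open>H\<close>- and \<open>D\<close>-coordinates of
  other values.
\<close>

lemma diagonal_DD:
  assumes "m \<le> two_ell k" "n \<le> two_ell k" "idx i"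
  shows "G (P m i) (P n i) DD = 0"
  using coord_HH(3)[OF G_carrier, of "P m i" "P n i"] diagonal_HH[of "m - 1" n i] diagonal_HH[of m "n - 1" i] assms
  by (simp add: equivariant_HH pointwise)

lemma diagonal_CC:
  assumes "m \<le> two_ell k" "n \<le> two_ell k" "idx i"
  shows "G (P m i) (P n i) CC = 0"
  using coord_HH(2)[OF G_carrier, of "P m i" "P n i"] diagonal_DD[of "m - 1" n i] diagonal_DD[of m "n - 1" i] assms
  by (simp add: equivariant_HH pointwise)

text \<open>
  The value commutes with all rotations, and \<open>so(d)\<close> has trivial centre: the coordinate at \<open>(p, q)\<close> is
  found in the bracket with \<open>rot q r\<close> for a third index \<open>r\<close>.
\<close>

lemma diagonal_rot:
  assumes m: "m \<le> two_ell k" and n: "n \<le> two_ell k" and i: "idx i" and pq: "idx p" "idx q" "p \<noteq> q"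
  shows "rcoord (G (P m i) (P n i)) p q = 0"
proof -
  obtain r where r: "idx r" "r \<noteq> p" "r \<noteq> q" using third_index[OF d] by blast
  have com: "br (rot a b) (G (P m i) (P n i)) = 0" if ab: "idx a" "idx b" "a \<noteq> b" for a b
  proof -
    consider "i \<noteq> a" "i \<noteq> b" | "i = a" | "i = b" by blast
    then show ?thesis
    proof cases
      case 1
      then show ?thesis
        unfolding equivariant[OF levi_vecs_rot[OF ab]] using m n i ab by (simp add: br_rot_PP G_lin)
    next
      case 2
      then show ?thesis using exchange(3)[OF m n ab] by simp
    next
      case 3
      then show ?thesis using exchange(3)[OF m n ab(2,1) ab(3)[symmetric]] rot_anti[of a b] by (simp add: br_lin)
    qed
  qed
  show ?thesis
    using coord_rot(6)[OF G_carrier pq(2) r(1) pq(1) r(1), of "P m i" "P n i"] com[OF pq(2) r(1) r(3)[symmetric]] pq r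
    by (simp add: rcoord_lin)
qed

text \<open>
  The mass coordinate and the coefficients \<open>b\<^sub>m\<close> satisfy the same ladder recursion, so they are
  proportional; the factor is read off at \<open>m = 0\<close>. It does not depend on the vector index by the exchange law.
\<close>

lemma G_PP_PP:
  "\<exists>c. \<forall>m n i j. m \<le> two_ell k \<longrightarrow> n \<le> two_ell k \<longrightarrow> idx i \<longrightarrow> idx j \<longrightarrow>
    G (P m i) (P n j) = scal c (br (P m i) (P n j))"
proof -
  have i1: "idx 1" using d by (simp add: idx_def)
  define \<beta> where "\<beta> c = G (P c 1) (P (two_ell k - c) 1) Mass" for c
  define c where "c = \<beta> 0 / mass_coeff k 0"
  define h where "h m = \<beta> m - c * mass_coeff k m" for m
  have rec: "of_nat (Suc a) * h a + of_nat (two_ell k - a) * h (Suc a) = 0" if a: "a < two_ell k" for a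
  proof -
    have 1: "of_nat (Suc a) * \<beta> a + of_nat (two_ell k - a) * \<beta> (Suc a) = 0"
      using step_HH[where lam = "\<lambda>v. v Mass", of "Suc a" "two_ell k - a" 1 1] a i1
      by (simp add: pointwise coord_HH \<beta>_def Suc_diff_le del: of_nat_Suc)
    have 2: "of_nat (Suc a) * mass_coeff k a + of_nat (two_ell k - a) * mass_coeff k (Suc a) = 0"
      using mass_coeff_lower[of "Suc a" "two_ell k - a" k] a by simp
    have "of_nat (Suc a) * h a + of_nat (two_ell k - a) * h (Suc a) =
      (of_nat (Suc a) * \<beta> a + of_nat (two_ell k - a) * \<beta> (Suc a))
      - c * (of_nat (Suc a) * mass_coeff k a + of_nat (two_ell k - a) * mass_coeff k (Suc a))"
      by (simp only: h_def) (simp add: algebra_simps del: of_nat_Suc)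
    also have "\<dots> = 0" unfolding 1 2 by simp
    finally show ?thesis .
  qed
  have h0: "h 0 = 0" by (simp add: h_def c_def mass_coeff_nonzero)
  have h: "\<beta> m = c * mass_coeff k m" if "m \<le> two_ell k" for m
  proof -
    have "h m = 0"
      by (rule chain_zero[OF rec _ _ _ h0 that]) (simp_all del: of_nat_Suc)
    then show ?thesis by (simp add: h_def)
  qed
  have "G (P m i) (P n j) = scal c (br (P m i) (P n j))"
    if m: "m \<le> two_ell k" and n: "n \<le> two_ell k" and i: "idx i" and j: "idx j" for m n i j
  proof (cases "i = j")
    case False
    then show ?thesis using off_diagonal[OF m n i j] m n i j by (simp add: br_PP_PP)
  next
    case True
    have M: "G (P m i) (P n i) Mass = c * (kdelta (m + n) (two_ell k) * mass_coeff k m)"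
    proof (cases "m + n = two_ell k")
      case True
      then have "two_ell k - m = n" by simp
      then have "G (P m 1) (P n 1) Mass = c * mass_coeff k m" using h[OF m] by (simp add: \<beta>_def)
      moreover have "G (P m i) (P n i) = G (P m 1) (P n 1)"
        using exchange(2)[OF m n i i1] by (cases "i = 1") auto
      ultimately show ?thesis using True by simp
    next
      case False
      then show ?thesis using weight_zero(2)[OF m n i i] by simp
    qed
    have "G (P m i) (P n i) = scal (c * (kdelta (m + n) (two_ell k) * mass_coeff k m)) (unit Mass)"
    proof (rule carrier_eqI[OF G_carrier carrier_scal[OF carrier_unit]])
      show "G (P m i) (P n i) (PP r s) = scal (c * (kdelta (m + n) (two_ell k) * mass_coeff k m)) (unit Mass) (PP r s)"
        if "r \<le> two_ell k" "idx s" for r s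
        using no_PP_part[OF m n i i that] by (simp add: pointwise)
    qed (simp_all add: pointwise rcoord_lin M diagonal_CC[OF m n i] diagonal_DD[OF m n i] diagonal_HH[OF m n i] diagonal_rot[OF m n i])
    then show ?thesis using True m n i by (simp add: br_PP_PP)
  qed
  then show ?thesis by blast
qed

text \<open>
  The parity of weights and the rotations leave \<open>G(P\<^sub>m\<^sub>i, M) = t\<^sub>m P\<^sub>m\<^sub>i\<close>. Equivariance under \<open>H\<close> makes
  \<open>t\<close> constant, and the cocycle identity at \<open>P\<^sub>0\<^sub>i, P\<^sub>2\<^sub>\<ell>\<^sub>,\<^sub>i, M\<close> reads \<open>2 t b\<^sub>0 M = 0\<close>.
\<close>

lemma G_PP_Mass:
  assumes n: "n \<le> two_ell k" and i: "idx i"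
  shows "G (P n i) (unit Mass) = 0"
proof -
  define t where "t m = G (P m i) (unit Mass) (PP m i)" for m
  have D: "br (unit DD) (G (P m i) (unit Mass)) = scal (of_nat (two_ell k) - 2 * of_nat m) (G (P m i) (unit Mass))"
    if "m \<le> two_ell k" for m
    using that i by (simp only: equivariant[OF levi_vecs_sl2(2)] br_DD_PP G_lin br_Mass) simp
  have odd: "of_nat (two_ell k) - 2 * of_nat m \<noteq> (2 * of_int a :: complex)" for m a
  proof
    assume "of_nat (two_ell k) - 2 * of_nat m = (2 * of_int a :: complex)"
    then have "of_int (int (two_ell k) - 2 * int m) = (of_int (2 * a) :: complex)" by simp
    then have "int (two_ell k) - 2 * int m = 2 * a" by (simp only: of_int_eq_iff)
    then show False by presburger
  qed
  have K: "G (P m i) (unit Mass) = scal (t m) (P m i)" if m: "m \<le> two_ell k" for m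
  proof (rule carrier_eqI[OF G_carrier carrier_scal[OF carrier_unit]])
    let ?v = "G (P m i) (unit Mass)"
    note e = D[OF m]
    have o: "of_nat (two_ell k) - 2 * of_nat m \<noteq> (0 :: complex)" "of_nat (two_ell k) - 2 * of_nat m \<noteq> (2 :: complex)"
      "of_nat (two_ell k) - 2 * of_nat m \<noteq> (- 2 :: complex)"
      using odd[of m 0] odd[of m 1] odd[of m "-1"] by simp_all
    have "(of_nat (two_ell k) - 2 * of_nat m) * ?v CC = -2 * ?v CC"
      using coord_DD(1)[OF G_carrier, of "P m i" "unit Mass"] unfolding e pointwise .
    then show "?v CC = scal (t m) (P m i) CC"
      using o(3) unfolding mult_cancel_right by (simp add: pointwise)
    show "?v DD = scal (t m) (P m i) DD"
      using coord_DD(2)[OF G_carrier, of "P m i" "unit Mass"] o(1) unfolding e pointwise mult_eq_0_iff by simp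
    have "(of_nat (two_ell k) - 2 * of_nat m) * ?v HH = 2 * ?v HH"
      using coord_DD(3)[OF G_carrier, of "P m i" "unit Mass"] unfolding e pointwise .
    then show "?v HH = scal (t m) (P m i) HH"
      using o(2) unfolding mult_cancel_right by (simp add: pointwise)
    show "?v Mass = scal (t m) (P m i) Mass"
      using coord_DD(4)[OF G_carrier, of "P m i" "unit Mass"] o(1) unfolding e pointwise mult_eq_0_iff by simp
    show "rcoord ?v p q = rcoord (scal (t m) (P m i)) p q" for p q
      using coord_DD(5)[OF G_carrier, of "P m i" "unit Mass" p q] o(1) unfolding e rcoord_lin mult_eq_0_iff by simp
    show "?v (PP r s) = scal (t m) (P m i) (PP r s)" if r: "r \<le> two_ell k" and s: "idx s" for r s
    proof (cases "r = m")
      case False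
      have "(of_nat (two_ell k) - 2 * of_nat m) * ?v (PP r s) = (of_nat (two_ell k) - 2 * of_nat r) * ?v (PP r s)"
        using coord_DD(6)[OF G_carrier r s, of "P m i" "unit Mass"] unfolding e pointwise .
      then show ?thesis using False unfolding mult_cancel_right by (simp add: pointwise unit_PP kdelta_def)
    next
      case True
      show ?thesis
      proof (cases "s = i")
        case False
        obtain q where q: "idx q" "q \<noteq> s" "q \<noteq> i" using third_index[OF d] by blast
        have "br (rot s q) ?v = 0"
          unfolding equivariant[OF levi_vecs_rot[OF s q(1) q(2)[symmetric]]]
          using m i s q False by (simp add: br_rot_PP G_lin)
        then have "?v (PP r s) = 0"
          using coord_rot(5)[OF G_carrier s q(1) r q(1), of "P m i" "unit Mass"] q(2) by (simp add: pointwise kdelta_def split: if_splits)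
        then show ?thesis using False True by (simp add: pointwise unit_PP)
      qed (use True in \<open>simp add: t_def pointwise\<close>)
    qed
  qed (use m i in simp)
  have tstep: "t (Suc m) = t m" if m: "Suc m \<le> two_ell k" for m
  proof -
    have "br (unit HH) (G (P (Suc m) i) (unit Mass)) = - scal (of_nat (Suc m)) (G (P m i) (unit Mass))"
      using m i by (simp only: equivariant[OF levi_vecs_sl2(3)] br_HH_PP G_lin br_Mass) simp
    then have "scal (t (Suc m)) (- scal (of_nat (Suc m)) (P m i)) = - scal (of_nat (Suc m)) (scal (t m) (P m i))"
      using m i K[of m] K[of "Suc m"] by (simp add: br_HH_PP br_lin del: of_nat_Suc)
    from fun_cong[OF this, of "PP m i"] show ?thesis by (simp add: pointwise del: of_nat_Suc)
  qed
  have t0: "t m = t 0" if "m \<le> two_ell k" for m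
    using that by (induction m) (use tstep in auto)
  have "t 0 = 0"
  proof -
    have "br (P 0 i) (G (P (two_ell k) i) (unit Mass)) - br (P (two_ell k) i) (G (P 0 i) (unit Mass)) = 0"
      using cocycle_eq[OF cG, of "P 0 i" "P (two_ell k) i" "unit Mass"] i
      by (simp add: br_PP_PP G_lin alt2_self[OF G])
    then have "scal (t 0) (br (P 0 i) (P (two_ell k) i)) - scal (t 0) (br (P (two_ell k) i) (P 0 i)) = 0"
      using K[of "two_ell k"] K[of 0] t0[of "two_ell k"] by (simp add: br_lin)
    from fun_cong[OF this, of Mass] have "t 0 * (mass_coeff k 0 - mass_coeff k (two_ell k)) = 0"
      using i by (simp add: br_PP_PP pointwise algebra_simps)
    moreover have "mass_coeff k (two_ell k) = - mass_coeff k 0"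
      by (rule mass_coeff_flip) simp
    ultimately show ?thesis by (simp add: mass_coeff_nonzero)
  qed
  then show ?thesis using K[OF n] t0[OF n] by simp
qed

text \<open>
  The map \<open>\<phi>\<close> with \<open>M \<mapsto> - c M\<close> and zero on the other generators takes values in the centre, so
  its coboundary is \<open>- \<phi> [x, y]\<close>, which is \<open>c\<close> times the mass part of the bracket.
\<close>

lemma relative_coboundary: "\<exists>\<phi>. endo \<phi> \<and> (\<forall>x y. G x y = cob \<phi> x y)"
proof -
  obtain c where c: "\<And>m n i j. m \<le> two_ell k \<Longrightarrow> n \<le> two_ell k \<Longrightarrow> idx i \<Longrightarrow> idx j \<Longrightarrow>
    G (P m i) (P n j) = scal c (br (P m i) (P n j))" using G_PP_PP by blast
  define \<phi> where "\<phi> = elem Mass (scal (- c) (unit Mass))"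
  have \<phi>: "endo \<phi>" unfolding \<phi>_def by (intro endo_elem carrier_scal carrier_unit) simp_all
  have cob: "cob \<phi> x y = scal (c * br x y Mass) (unit Mass)" for x y
    by (simp add: cob_def \<phi>_def elem_def br_lin) (simp add: fun_eq_iff pointwise)
  have S: "br (unit s) v Mass = 0" if "s \<in> levi" for s v
  proof -
    have "br (unit s) (proj v) Mass = 0"
      using that
    proof (rule levi_cases)
      fix i j assume "s = Rot i j" "idx i" "idx j" "i < j"
      then show ?thesis using coord_rot(4)[OF proj_carrier, of i j v] by (simp add: rot_less)
    qed (simp_all add: coord_CC coord_DD coord_HH)
    then show ?thesis by (simp add: brD(3))
  qed
  have "G x y = cob \<phi> x y" for x y
  proof (rule alt2_eqI[OF G alt2_cob[OF \<phi>]])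
    fix a b assume a: "a \<in> BB" and b: "b \<in> BB"
    consider "a \<in> levi" | "b \<in> levi" | "a \<notin> levi" "b \<notin> levi" by blast
    then show "G (unit a) (unit b) = cob \<phi> (unit a) (unit b)"
    proof cases
      case 1
      then show ?thesis by (simp add: rel cob S)
    next
      case 2
      then show ?thesis
        using alt2_anti[OF G, of "unit a" "unit b"] br_anti[of "unit a" "unit b"] by (simp add: rel cob S pointwise)
    next
      case 3
      have PM: "G (unit a) (unit b) = cob \<phi> (unit a) (unit b)" if "b = Mass"
        using a 3(1) by (rule radical_cases) (use that G_PP_Mass in \<open>simp_all add: cob alt2_self[OF G] pointwise\<close>)
      have MP: "G (unit a) (unit b) = cob \<phi> (unit a) (unit b)" if "a = Mass"
        using b 3(2) by (rule radical_cases) (use that G_PP_Mass alt2_anti[OF G, of "unit Mass"] in \<open>simp_all add: cob alt2_self[OF G] pointwise\<close>)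
      show ?thesis
        using a 3(1)
      proof (rule radical_cases)
        fix m i assume A: "a = PP m i" "m \<le> two_ell k" "idx i"
        show ?thesis
          using b 3(2)
        proof (rule radical_cases)
          fix n j assume "b = PP n j" "n \<le> two_ell k" "idx j"
          with A show ?thesis by (simp add: c cob br_PP_PP pointwise)
        qed (rule PM)
      qed (rule MP)
    qed
  qed
  with \<phi> show ?thesis by blast
qed

end

context cga
begin

lemma cocycle_is_coboundary:
  assumes d: "d \<ge> 3" and c: "cocycle F"
  shows "\<exists>\<phi>. endo \<phi> \<and> (\<forall>x y. F x y = cob \<phi> x y)"
proof -
  obtain \<phi> where \<phi>: "endo \<phi>" and rel: "\<forall>s\<in>levi. \<forall>v. F (unit s) v - cob \<phi> (unit s) v = 0"
    using relative_cocycle[OF d c] by blast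
  interpret relative_cga d k "\<lambda>x y. F x y - cob \<phi> x y"
    by unfold_locales (use d rel cocycle_diff[OF c cocycle_cob[OF \<phi>]] in auto)
  obtain \<psi> where \<psi>: "endo \<psi>" "\<forall>x y. F x y - cob \<phi> x y = cob \<psi> x y"
    using relative_coboundary by blast
  then have "F x y = cob (\<lambda>x. \<phi> x + \<psi> x) x y" for x y
    by (metis cob_add diff_eq_eq add.commute)
  with endo_add[OF \<phi> \<psi>(1)] show ?thesis by blast
qed

end

theorem theorem5p1:
  fixes d k :: nat
  assumes "d \<ge> 3"
  shows "adjoint_cohomology cga_scale (cga_carrier d k) (cga_bracket d k) 2 =
           {adjoint_coboundaries cga_scale (cga_carrier d k) (cga_bracket d k) 2}"
proof -
  interpret cga d k .
  have "carrier = cga_carrier d k"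
    by (simp add: carrier_def cga_carrier_def)
  then show ?thesis
    using cohomology_2_trivial[OF cocycle_is_coboundary[OF assms]]
    by (simp add: cga_scale_eq cga_bracket_eq)
qed

end
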